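(* Let $n,p\in\mathbb N$, let $\lambda\ge\mu\ge 0$, $l\ge 0$, $\delta\ge0$ be real, let $-1\le A<B\le 1$, $0<B\le 1$, $0\le\sigma<p$, and let $\nu>0$, $\vartheta>-p$ be real. Let $f(z)=z^p-\sum_{k=n+p}^\infty|a_k|z^k$ be in the class $\widetilde{\mathcal P}_{\lambda,\mu,l}^{\delta}(A,B;\sigma,p)$. Then for all $z\in\mathcal U$, $$\left|\mathcal D_z^{-\nu}\{(\mathcal I_{\vartheta,p}f)(z)\}\right|\ge\left\{\frac{\Gamma(p+1)}{\Gamma(p+1+\nu)}-\frac{(\vartheta+p)\Gamma(n+p+1)(B-A)(p-\sigma)}{(\vartheta+n+p)\Gamma(n+p+1+\nu)(n+p)(1+B)\Phi_p^{n+p}(\delta,\lambda,\mu,l)}|z|^n\right\}|z|^{p+\nu}$$ and $$\left|\mathcal D_z^{-\nu}\{(\mathcal I_{\vartheta,p}f)(z)\}\right|\le\left\{\frac{\Gamma(p+1)}{\Gamma(p+1+\nu)}+\frac{(\vartheta+p)\Gamma(n+p+1)(B-A)(p-\sigma)}{(\vartheta+n+p)\Gamma(n+p+1+\nu)(n+p)(1+B)\Phi_p^{n+p}(\delta,\lambda,\mu,l)}|z|^n\right\}|z|^{p+\nu}.$$ Each of these two assertions is sharp.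
   Context: $\mathbb N=\{1,2,3,\dots\}$ and $\mathcal U=\{z\in\mathbb C:|z|<1\}$. $\mathcal A(n,p)$ is the class of functions $f(z)=z^p+\sum_{k=n+p}^\infty a_kz^k$ that are analytic and $p$-valent in $\mathcal U$ ($p$-valent: no value is taken more than $p$ times in $\mathcal U$, counted with multiplicity, and some value is taken exactly $p$ times). For $k\ge n+p$ put $$\Phi_p^k(\delta,\lambda,\mu,l)=\left[\frac{(k-p)(\lambda\mu k+\lambda-\mu)+p+l}{p+l}\right]^{\delta},\qquad \mathcal J_p^\delta(\lambda,\mu,l)f(z)=z^p+\sum_{k=n+p}^\infty\Phi_p^k(\delta,\lambda,\mu,l)\,a_kz^k .$$ For $F,G$ analytic in $\mathcal U$, $F\prec G$ (subordination) means $F(z)=G(w(z))$ in $\mathcal U$ for some analytic $w:\mathcal U\to\mathbb C$ with $w(0)=0$, $|w(z)|<1$. The class $\mathcal P_{\lambda,\mu,l}^{\delta}(A,B;\sigma,p)$ consists of all $f\in\mathcal A(n,p)$ with $$\frac1{p-\sigma}\left(\frac{[\mathcal J_p^\delta(\lambda,\mu,l)f(z)]'}{z^{p-1}}-\sigma\right)\prec\frac{1+Az}{1+Bz}\quad(z\in\mathcal U)$$ (the quotient by $z^{p-1}$ being extended analytically to $z=0$), and $\widetilde{\mathcal P}_{\lambda,\mu,l}^{\delta}(A,B;\sigma,p)$ is the subclass of those $f$ of the form $f(z)=z^p-\sum_{k=n+p}^\infty|a_k|z^k$. Integral operator: for $\vartheta>-p$ and $f\in\mathcal A(n,p)$, $$(\mathcal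 I_{\vartheta,p}f)(z)=\frac{\vartheta+p}{z^{\vartheta}}\int_0^zt^{\vartheta-1}f(t)\,dt .$$ Fractional integral of order $\nu>0$ of a function $F$ analytic in a simply connected region containing the origin: $$\mathcal D_z^{-\nu}F(z)=\frac1{\Gamma(\nu)}\int_0^z\frac{F(\zeta)}{(z-\zeta)^{1-\nu}}\,d\zeta,$$ where the multiplicity of $(z-\zeta)^{\nu-1}$ is removed by requiring $\log(z-\zeta)$ to be real for $z-\zeta>0$ (the integral may be taken along the segment from $0$ to $z$, and its modulus does not depend on the branch). "Sharp" means that there is a function in the class for which equality is attained at suitable points $z\ne0$ of $\mathcal U$. *)

theory Defs
  imports "HOL-Complex_Analysis.Complex_Analysis"
begin

abbreviation unit_disc :: "complex set" where
  "unit_disc \<equiv> ball 0 1"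

text \<open>
  The values of f outside the disc are irrelevant. On the zeros of f - w, zorder is the usual
  multiplicity when f is analytic and nonconstant on the disc; a constant f is excluded by
  the finiteness condition.
\<close>

definition p_valent :: "nat \<Rightarrow> (complex \<Rightarrow> complex) \<Rightarrow> bool" where
  "p_valent p f \<longleftrightarrow>
     (\<forall>w. finite {z \<in> unit_disc. f z = w} \<and>
          (\<Sum>z | z \<in> unit_disc \<and> f z = w. zorder (\<lambda>u. f u - w) z) \<le> int p) \<and>
     (\<exists>w. (\<Sum>z | z \<in> unit_disc \<and> f z = w. zorder (\<lambda>u. f u - w) z) = int p)"

definition class_A :: "nat \<Rightarrow> nat \<Rightarrow> (complex \<Rightarrow> complex) set" where
  "class_A n p = {f. f holomorphic_on unit_disc \<and>
     (\<exists>a :: nat \<Rightarrow> complex. \<forall>z\<in>unit_disc. ((\<lambda>k. a k * z ^ k) has_sum (f z - z ^ p)) {n + p..}) \<and>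
     p_valent p f}"

definition Phi :: "nat \<Rightarrow> real \<Rightarrow> real \<Rightarrow> real \<Rightarrow> real \<Rightarrow> nat \<Rightarrow> real" where
  "Phi p \<delta> lam \<mu> l k =
     (((real k - real p) * (lam * \<mu> * real k + lam - \<mu>) + real p + l) / (real p + l)) powr \<delta>"

definition J_op :: "nat \<Rightarrow> nat \<Rightarrow> real \<Rightarrow> real \<Rightarrow> real \<Rightarrow> real \<Rightarrow> (complex \<Rightarrow> complex) \<Rightarrow> complex \<Rightarrow> complex" where
  "J_op n p \<delta> lam \<mu> l f z =
     z ^ p + (\<Sum>\<^sub>\<infinity>k\<in>{n + p..}.
                of_real (Phi p \<delta> lam \<mu> l k) * fps_nth (fps_expansion f 0) k * z ^ k)"

definition subordinate :: "(complex \<Rightarrow> complex) \<Rightarrow> (complex \<Rightarrow> complex) \<Rightarrow> bool" where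
  "subordinate F G \<longleftrightarrow>
     F holomorphic_on unit_disc \<and> G holomorphic_on unit_disc \<and>
     (\<exists>w. w holomorphic_on unit_disc \<and> w 0 = 0 \<and>
          (\<forall>z\<in>unit_disc. norm (w z) < 1 \<and> F z = G (w z)))"

text \<open>
  The removable singularity at 0 of the quotient by z^(p-1) is filled in by \<^const>\<open>remove_sings\<close>.
\<close>

definition class_P ::
  "nat \<Rightarrow> nat \<Rightarrow> real \<Rightarrow> real \<Rightarrow> real \<Rightarrow> real \<Rightarrow> real \<Rightarrow> real \<Rightarrow> real \<Rightarrow> (complex \<Rightarrow> complex) set" where
  "class_P n p \<delta> lam \<mu> l A B \<sigma> = {f \<in> class_A n p.
     subordinate
       (\<lambda>z. 1 / (of_nat p - of_real \<sigma>) *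
            (remove_sings (\<lambda>u. deriv (J_op n p \<delta> lam \<mu> l f) u / u ^ (p - 1)) z - of_real \<sigma>))
       (\<lambda>z. (1 + of_real A * z) / (1 + of_real B * z))}"

definition class_P_tilde ::
  "nat \<Rightarrow> nat \<Rightarrow> real \<Rightarrow> real \<Rightarrow> real \<Rightarrow> real \<Rightarrow> real \<Rightarrow> real \<Rightarrow> real \<Rightarrow> (complex \<Rightarrow> complex) set" where
  "class_P_tilde n p \<delta> lam \<mu> l A B \<sigma> = {f \<in> class_P n p \<delta> lam \<mu> l A B \<sigma>.
     \<exists>a :: nat \<Rightarrow> complex. \<forall>z\<in>unit_disc.
       ((\<lambda>k. of_real (norm (a k)) * z ^ k) has_sum (z ^ p - f z)) {n + p..}}"

text \<open>
  In the next two definitions the integral from 0 to z is taken along the segment. The principal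
  logarithm has constant argument on the ray through z, so the principal powers are a consistent
  choice of branch along the segment, real on the positive axis. At z = 0 both operators take the
  value 0 (division by \<^term>\<open>0 powr a = 0\<close>, respectively a trivial path), which is the value of the
  continuous extension when f is in class A(n,p).
\<close>

definition I_op :: "real \<Rightarrow> nat \<Rightarrow> (complex \<Rightarrow> complex) \<Rightarrow> complex \<Rightarrow> complex" where
  "I_op \<theta> p f z =
     of_real (\<theta> + real p) / z powr of_real \<theta> *
     contour_integral (linepath 0 z) (\<lambda>t. t powr of_real (\<theta> - 1) * f t)"

definition frac_integral :: "real \<Rightarrow> (complex \<Rightarrow> complex) \<Rightarrow> complex \<Rightarrow> complex" where
  "frac_integral \<nu> F z =
     1 / of_real (Gamma \<nu>) *
     contour_integral (linepath 0 z) (\<lambda>\<zeta>. F \<zeta> / (z - \<zeta>) powr of_real (1 - \<nu>))"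

definition bound_coeff ::
  "nat \<Rightarrow> nat \<Rightarrow> real \<Rightarrow> real \<Rightarrow> real \<Rightarrow> real \<Rightarrow> real \<Rightarrow> real \<Rightarrow> real \<Rightarrow> real \<Rightarrow> real \<Rightarrow> real" where
  "bound_coeff n p \<delta> lam \<mu> l A B \<sigma> \<nu> \<theta> =
     ((\<theta> + real p) * Gamma (real n + real p + 1) * (B - A) * (real p - \<sigma>)) /
     ((\<theta> + real n + real p) * Gamma (real n + real p + 1 + \<nu>) * (real n + real p) * (1 + B) *
        Phi p \<delta> lam \<mu> l (n + p))"

definition lower_bound ::
  "nat \<Rightarrow> nat \<Rightarrow> real \<Rightarrow> real \<Rightarrow> real \<Rightarrow> real \<Rightarrow> real \<Rightarrow> real \<Rightarrow> real \<Rightarrow> real \<Rightarrow> real \<Rightarrow> complex \<Rightarrow> real" where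
  "lower_bound n p \<delta> lam \<mu> l A B \<sigma> \<nu> \<theta> z =
     (Gamma (real p + 1) / Gamma (real p + 1 + \<nu>)
        - bound_coeff n p \<delta> lam \<mu> l A B \<sigma> \<nu> \<theta> * norm z ^ n) * norm z powr (real p + \<nu>)"

definition upper_bound ::
  "nat \<Rightarrow> nat \<Rightarrow> real \<Rightarrow> real \<Rightarrow> real \<Rightarrow> real \<Rightarrow> real \<Rightarrow> real \<Rightarrow> real \<Rightarrow> real \<Rightarrow> real \<Rightarrow> complex \<Rightarrow> real" where
  "upper_bound n p \<delta> lam \<mu> l A B \<sigma> \<nu> \<theta> z =
     (Gamma (real p + 1) / Gamma (real p + 1 + \<nu>)
        + bound_coeff n p \<delta> lam \<mu> l A B \<sigma> \<nu> \<theta> * norm z ^ n) * norm z powr (real p + \<nu>)"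

end

theory Submission
  imports Defs "HOL-Real_Asymp.Real_Asymp"
begin

text \<open>
  Write \<open>f z = z ^ p * (1 - (\<Sum>m\<ge>n. e m * z ^ m))\<close> with \<open>e m \<ge> 0\<close>. On such series all operators act
  diagonally: \<open>J_op\<close> multiplies the coefficient of \<open>z ^ (p + m)\<close> by \<open>Phi p \<delta> lam \<mu> l (m + p)\<close>, the two
  integral operators by \<open>(\<theta> + p) / (\<theta> + p + m)\<close> and by \<open>Gamma (p + m + 1) / Gamma (p + m + 1 + \<nu>)\<close>. For
  the latter two this is a Beta integral, evaluated term by term
  (\<open>Beta_weighted_power_series_has_integral\<close>).

  A function subordinate to \<open>(1 + A * z) / (1 + B * z)\<close> has real part at least \<open>(1 + A) / (1 + B)\<close>.
  Evaluated on the positive radius, where the signs of the coefficients add up, this yields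
  \<open>(\<Sum>m. (p + m) * Phi p \<delta> lam \<mu> l (m + p) * e m) \<le> (p - \<sigma>) * (B - A) / (1 + B)\<close>
  (\<open>class_P_tilde_coefficients\<close>). The multiplier of \<open>e m\<close> in this inequality increases with \<open>m\<close>,
  whereas the weights of the integral operators decrease, so the sum that perturbs the leading term
  is controlled by the first index \<open>n\<close>. This gives both bounds (\<open>distortion_bounds\<close>).

  Equality holds for \<open>z ^ p - c * z ^ (n + p)\<close> with the largest \<open>c\<close> that the inequality permits, at a
  positive point for the lower bound and at a point with \<open>z ^ n < 0\<close> for the upper one. The delicate
  part is that this polynomial is \<open>p\<close>-valent in the disc. As \<open>(n + p) * c \<le> p\<close>, it is the \<open>p\<close>-th power
  of an analytic function whose derivative has positive real part and which is therefore injective;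
  hence nonzero values are taken at most \<open>p\<close> times (\<open>p_valent_two_term\<close>).
\<close>

section \<open>Power series in the disc\<close>

text \<open>
  Every function in the argument is \<open>z ^ p\<close> times a convergent power series. Splitting off \<open>z ^ p\<close>
  makes the operators diagonal: each one multiplies the coefficient of index \<open>m\<close> by a number.
\<close>

definition disc_series :: "nat \<Rightarrow> (nat \<Rightarrow> complex) \<Rightarrow> (complex \<Rightarrow> complex) \<Rightarrow> bool" where
  "disc_series p \<beta> f \<longleftrightarrow>
     (\<forall>z\<in>unit_disc. summable (\<lambda>m. \<beta> m * z ^ m) \<and> f z = z ^ p * (\<Sum>m. \<beta> m * z ^ m))"

lemma abs_summable_in_disc:
  fixes z :: complex
  assumes "\<And>z. z \<in> unit_disc \<Longrightarrow> summable (\<lambda>m. \<beta> m * z ^ m)" "norm z < 1"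
  shows "summable (\<lambda>m. norm (\<beta> m * z ^ m))"
proof (rule powser_insidea)
  define s where "s = (1 + norm z) / 2"
  have "0 \<le> s" "norm z < s" "s < 1"
    using assms(2) norm_ge_zero[of z] by (auto simp: s_def simp del: norm_ge_zero)
  then have s: "norm (of_real s :: complex) = s" by simp
  show "summable (\<lambda>m. \<beta> m * of_real s ^ m)"
    by (rule assms(1)) (use s \<open>s < 1\<close> in simp)
  show "norm z < norm (of_real s :: complex)"
    using s \<open>norm z < s\<close> by simp
qed

lemma summable_bounded_multiplier:
  fixes x :: "nat \<Rightarrow> complex"
  assumes "summable (\<lambda>m. norm (x m))" and "\<And>m. \<bar>c m\<bar> \<le> C"
  shows "summable (\<lambda>m. norm (of_real (c m) * x m))"
proof (rule summable_comparison_test')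
  show "summable (\<lambda>m. C * norm (x m))" using assms(1) by (rule summable_mult)
  show "norm (norm (of_real (c m) * x m)) \<le> C * norm (x m)" if "m \<ge> 0" for m
    using assms(2)[of m] by (simp add: norm_mult mult_right_mono)
qed

section \<open>The integral operators on power series\<close>

text \<open>
  Both integral operators reduce to this one: after the substitution \<open>t = x * z\<close> the integrand is a
  Beta density times a power series in \<open>x\<close>. Termwise integration is dominated convergence with the
  density times the sum of the absolute values of the coefficients as majorant.
\<close>

lemma Beta_weighted_power_series_has_integral:
  fixes a b :: real and \<beta> :: "nat \<Rightarrow> complex"
  assumes a: "a > 0" and b: "b > 0" and sm: "summable (\<lambda>m. norm (\<beta> m))"
  shows "((\<lambda>x. of_real (x powr (a - 1) * (1 - x) powr (b - 1)) * (\<Sum>m. \<beta> m * of_real x ^ m))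
           has_integral (\<Sum>m. of_real (Beta (a + real m) b) * \<beta> m)) {0<..<1}"
proof -
  define W where "W = (\<lambda>x::real. x powr (a - 1) * (1 - x) powr (b - 1))"
  have W0: "W x \<ge> 0" for x by (simp add: W_def)
  define M where "M = (\<Sum>m. norm (\<beta> m))"
  have Wint: "(W has_integral Beta a b) {0<..<1}"
    using has_integral_Beta_real[OF a b] unfolding W_def by (simp add: has_integral_Icc_iff_Ioo)
  have moment: "((\<lambda>x. W x * x ^ m) has_integral Beta (a + real m) b) {0<..<1}" for m
  proof -
    have "((\<lambda>x. x powr (a + real m - 1) * (1 - x) powr (b - 1)) has_integral Beta (a + real m) b) {0<..<1}"
      using has_integral_Beta_real[of "a + real m" b] a b by (simp add: has_integral_Icc_iff_Ioo)
    then show ?thesis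
    proof (rule has_integral_eq[rotated])
      fix x :: real assume "x \<in> {0<..<1}"
      then show "x powr (a + real m - 1) * (1 - x) powr (b - 1) = W x * x ^ m"
        by (simp add: W_def powr_add powr_diff powr_realpow field_simps)
    qed
  qed
  have Beta_nonneg: "0 \<le> Beta (a + real m) b" for m
    using moment[of m] by (rule has_integral_nonneg) (auto simp: W0)
  have Beta_mono: "Beta (a + real m) b \<le> Beta a b" for m
    using moment[of m] Wint by (rule has_integral_le) (auto simp: W0 power_le_one mult_left_le)
  have monom: "((\<lambda>x. of_real (W x) * (\<beta> m * of_real x ^ m)) has_integral
                (of_real (Beta (a + real m) b) * \<beta> m)) {0<..<1}" for m
    using has_integral_mult_left[OF has_integral_of_real[OF moment[of m]], of "\<beta> m"]
    by (simp add: mult_ac)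
  have sm': "summable (\<lambda>m. of_real (Beta (a + real m) b) * \<beta> m)"
    by (rule summable_norm_cancel, rule summable_bounded_multiplier[OF sm, of _ "Beta a b"])
       (use Beta_nonneg Beta_mono in simp)
  have smx: "summable (\<lambda>m. norm (\<beta> m * of_real x ^ m))" if "x \<in> {0<..<1}" for x
    using sm by (rule summable_comparison_test') 
      (use that in \<open>auto simp: norm_mult norm_power power_le_one mult_left_le\<close>)
  have "((\<lambda>x. of_real (W x) * (\<Sum>m. \<beta> m * of_real x ^ m))
           has_integral (\<Sum>m. of_real (Beta (a + real m) b) * \<beta> m)) {0<..<1}"
  proof (rule has_integral_dominated_convergence[where h = "\<lambda>x. W x * M"
        and f = "\<lambda>k x. \<Sum>m<k. of_real (W x) * (\<beta> m * of_real x ^ m)"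
        and y = "\<lambda>k. \<Sum>m<k. of_real (Beta (a + real m) b) * \<beta> m"])
    show "((\<lambda>x. \<Sum>m<k. of_real (W x) * (\<beta> m * of_real x ^ m)) has_integral
             (\<Sum>m<k. of_real (Beta (a + real m) b) * \<beta> m)) {0<..<1}" for k
      by (intro has_integral_sum monom) auto
    show "(\<lambda>x. W x * M) integrable_on {0<..<1}"
      using Wint by (intro integrable_on_mult_left) auto
    show "\<forall>x\<in>{0<..<1}. norm (\<Sum>m<k. of_real (W x) * (\<beta> m * of_real x ^ m)) \<le> W x * M" for k
    proof
      fix x :: real assume x: "x \<in> {0<..<1}"
      have "norm (\<Sum>m<k. of_real (W x) * (\<beta> m * of_real x ^ m))
            = W x * norm (\<Sum>m<k. \<beta> m * of_real x ^ m)"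
        by (simp only: sum_distrib_left[symmetric] norm_mult) (simp add: W0)
      also have "norm (\<Sum>m<k. \<beta> m * of_real x ^ m) \<le> (\<Sum>m<k. norm (\<beta> m))"
        by (rule sum_norm_le) (use x in \<open>auto simp: norm_mult norm_power power_le_one mult_left_le\<close>)
      also have "\<dots> \<le> M"
        unfolding M_def by (rule sum_le_suminf[OF sm]) auto
      finally show "norm (\<Sum>m<k. of_real (W x) * (\<beta> m * of_real x ^ m)) \<le> W x * M"
        by (simp add: W0 mult_left_mono)
    qed
    show "\<forall>x\<in>{0<..<1}. (\<lambda>k. \<Sum>m<k. of_real (W x) * (\<beta> m * of_real x ^ m))
            \<longlonglongrightarrow> of_real (W x) * (\<Sum>m. \<beta> m * of_real x ^ m)"
    proof
      fix x :: real assume x: "x \<in> {0<..<1}"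
      show "(\<lambda>k. \<Sum>m<k. of_real (W x) * (\<beta> m * of_real x ^ m))
              \<longlonglongrightarrow> of_real (W x) * (\<Sum>m. \<beta> m * of_real x ^ m)"
        unfolding sum_distrib_left[symmetric]
        by (intro tendsto_mult_left summable_LIMSEQ summable_norm_cancel[OF smx[OF x]])
    qed
    show "(\<lambda>k. \<Sum>m<k. of_real (Beta (a + real m) b) * \<beta> m)
            \<longlonglongrightarrow> (\<Sum>m. of_real (Beta (a + real m) b) * \<beta> m)"
      using sm' by (rule summable_LIMSEQ)
  qed
  then show ?thesis by (simp only: W_def)
qed

lemma contour_integral_linepath_Beta_series:
  fixes a b :: real and \<beta> :: "nat \<Rightarrow> complex" and z K :: complex
  assumes "a > 0" "b > 0" "summable (\<lambda>m. norm (\<beta> m))"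
    and eq: "\<And>x. x \<in> {0<..<1} \<Longrightarrow> h (of_real x * z) * z =
               K * (of_real (x powr (a - 1) * (1 - x) powr (b - 1)) * (\<Sum>m. \<beta> m * of_real x ^ m))"
  shows "contour_integral (linepath 0 z) h = K * (\<Sum>m. of_real (Beta (a + real m) b) * \<beta> m)"
proof (rule contour_integral_unique)
  have "((\<lambda>x. K * (of_real (x powr (a - 1) * (1 - x) powr (b - 1)) * (\<Sum>m. \<beta> m * of_real x ^ m)))
           has_integral K * (\<Sum>m. of_real (Beta (a + real m) b) * \<beta> m)) {0<..<1}"
    by (intro has_integral_mult_right Beta_weighted_power_series_has_integral assms)
  then have "((\<lambda>x. h (of_real x * z) * z) has_integral
               K * (\<Sum>m. of_real (Beta (a + real m) b) * \<beta> m)) {0<..<1}"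
    by (rule has_integral_eq[rotated]) (use eq in auto)
  then show "(h has_contour_integral K * (\<Sum>m. of_real (Beta (a + real m) b) * \<beta> m)) (linepath 0 z)"
    unfolding has_contour_integral_linepath has_integral_Icc_iff_Ioo
    by (simp only: linepath_def scaleR_conv_of_real diff_zero add_0 scaleR_zero_right mult_zero_right)
qed

text \<open>
  On a ray from the origin the principal power is multiplicative in the positive real factor, so no
  branch cut interferes with the substitution \<open>t = x * z\<close>.
\<close>

lemma of_real_mult_powr:
  assumes "x > 0"
  shows "(of_real x * z) powr of_real s = of_real (x powr s) * z powr (of_real s :: complex)"
  using assms by (subst powr_times_real_left) (auto simp: powr_of_real)

lemma contraction_in_unit_disc:
  fixes z :: complex
  assumes "z \<in> unit_disc" "x \<in> {0<..<1}"
  shows "of_real x * z \<in> unit_disc"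
  using assms by (auto simp: norm_mult intro: le_less_trans[OF mult_left_le_one_le])

text \<open>
  The weight is \<open>x powr (\<theta> + p - 1)\<close>, a Beta density with second parameter 1 that is integrable
  because \<open>\<theta> > - p\<close>; its moments \<open>Beta (\<theta> + p + m) 1 = 1 / (\<theta> + p + m)\<close> are the multipliers.
\<close>

lemma I_op_disc_series:
  assumes f: "disc_series p \<beta> f" and p: "p \<ge> 1" and \<theta>: "- real p < \<theta>"
  shows "disc_series p (\<lambda>m. of_real ((\<theta> + real p) / (\<theta> + real p + real m)) * \<beta> m) (I_op \<theta> p f)"
  unfolding disc_series_def
proof (intro ballI conjI)
  fix z :: complex assume z: "z \<in> unit_disc"
  have sm: "summable (\<lambda>m. norm (\<beta> m * z ^ m))"
    using f z by (intro abs_summable_in_disc) (auto simp: disc_series_def)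
  have pos: "\<theta> + real p + real m > 0" for m using \<theta> by linarith
  have sm': "summable (\<lambda>m. norm (of_real (c / (\<theta> + real p + real m)) * (\<beta> m * z ^ m)))" for c
  proof (rule summable_bounded_multiplier[OF sm])
    show "\<bar>c / (\<theta> + real p + real m)\<bar> \<le> \<bar>c\<bar> / (\<theta> + real p)" for m
      using pos[of m] pos[of 0] by (simp add: frac_le)
  qed
  show "summable (\<lambda>m. of_real ((\<theta> + real p) / (\<theta> + real p + real m)) * \<beta> m * z ^ m)"
    using summable_norm_cancel[OF sm'[of "\<theta> + real p"]] by (simp add: mult_ac)
  show "I_op \<theta> p f z = z ^ p * (\<Sum>m. of_real ((\<theta> + real p) / (\<theta> + real p + real m)) * \<beta> m * z ^ m)"
  proof (cases "z = 0")
    case True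
    then show ?thesis using p by (simp add: I_op_def)
  next
    case False
    have zz: "z powr of_real (\<theta> - 1) * z = z powr of_real \<theta>"
      using False by (simp add: powr_diff)
    have "contour_integral (linepath 0 z) (\<lambda>t. t powr of_real (\<theta> - 1) * f t)
        = z powr of_real \<theta> * z ^ p *
          (\<Sum>m. of_real (Beta (\<theta> + real p + real m) 1) * (\<beta> m * z ^ m))"
    proof (rule contour_integral_linepath_Beta_series)
      fix x :: real assume x: "x \<in> {0<..<1}"
      have xx: "x powr (\<theta> - 1) * x ^ p = x powr (\<theta> + real p - 1)"
        using x by (simp add: powr_diff powr_add powr_realpow)
      have "f (of_real x * z) = (of_real x * z) ^ p * (\<Sum>m. \<beta> m * (of_real x * z) ^ m)"
        using f contraction_in_unit_disc[OF z x] by (simp add: disc_series_def)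
      then have "(of_real x * z) powr of_real (\<theta> - 1) * f (of_real x * z) * z =
         of_real (x powr (\<theta> - 1) * x ^ p) * ((z powr of_real (\<theta> - 1) * z) * z ^ p *
         (\<Sum>m. \<beta> m * (of_real x * z) ^ m))"
        using of_real_mult_powr[of x z "\<theta> - 1"] x
        by (simp add: power_mult_distrib mult_ac del: of_real_diff)
      then show "(of_real x * z) powr of_real (\<theta> - 1) * f (of_real x * z) * z =
         z powr of_real \<theta> * z ^ p * (of_real (x powr (\<theta> + real p - 1) * (1 - x) powr (1 - 1)) *
         (\<Sum>m. \<beta> m * z ^ m * of_real x ^ m))"
        unfolding xx zz using x by (simp add: power_mult_distrib mult_ac)
    qed (use \<theta> sm in auto)
    moreover have "Beta (\<theta> + real p + real m) 1 = 1 / (\<theta> + real p + real m)" for m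
    proof -
      have "\<theta> + real p + real m \<notin> \<int>\<^sub>\<le>\<^sub>0"
        using pos[of m] by (auto elim!: nonpos_Ints_cases)
      moreover have "Gamma (\<theta> + real p + real m) > 0"
        using pos[of m] by (rule Gamma_real_pos)
      ultimately show ?thesis
        by (simp add: Beta_def Gamma_plus1)
    qed
    ultimately have "I_op \<theta> p f z = of_real (\<theta> + real p) * (z ^ p *
        (\<Sum>m. of_real (1 / (\<theta> + real p + real m)) * (\<beta> m * z ^ m)))"
      using False by (simp add: I_op_def)
    also have "\<dots> = z ^ p * (\<Sum>m. of_real (\<theta> + real p) *
        (of_real (1 / (\<theta> + real p + real m)) * (\<beta> m * z ^ m)))"
      by (subst suminf_mult[OF summable_norm_cancel[OF sm']]) (simp add: mult_ac)
    finally show ?thesis by (simp add: mult_ac)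
  qed
qed

text \<open>
  Passing from \<open>k\<close> to \<open>Suc k\<close> multiplies the ratio by \<open>(k + 1) / (k + 1 + \<nu>) < 1\<close>.
\<close>

lemma Gamma_ratio_antimono:
  fixes \<nu> :: real
  assumes "\<nu> > 0" "i \<le> j"
  shows "Gamma (real j + 1) / Gamma (real j + 1 + \<nu>) \<le> Gamma (real i + 1) / Gamma (real i + 1 + \<nu>)"
  using \<open>i \<le> j\<close>
proof (rule lift_Suc_antimono_le[rotated])
  fix k :: nat
  have "real k + 1 \<notin> \<int>\<^sub>\<le>\<^sub>0" and nn: "real k + 1 + \<nu> \<notin> \<int>\<^sub>\<le>\<^sub>0"
    using \<open>\<nu> > 0\<close> by (auto elim!: nonpos_Ints_cases)
  then have "Gamma (real (Suc k) + 1) = (real k + 1) * Gamma (real k + 1)"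
    using Gamma_plus1[of "real k + 1"] by (simp add: add.commute)
  moreover have "Gamma (real (Suc k) + 1 + \<nu>) = (real k + 1 + \<nu>) * Gamma (real k + 1 + \<nu>)"
    using Gamma_plus1[of "real k + 1 + \<nu>"] nn by (simp add: algebra_simps)
  moreover have "Gamma (real k + 1) > 0" "Gamma (real k + 1 + \<nu>) > 0"
    using \<open>\<nu> > 0\<close> by (auto intro!: Gamma_real_pos)
  ultimately show "Gamma (real (Suc k) + 1) / Gamma (real (Suc k) + 1 + \<nu>)
      \<le> Gamma (real k + 1) / Gamma (real k + 1 + \<nu>)"
    using \<open>\<nu> > 0\<close> by (simp add: divide_simps mult_ac)
qed

text \<open>
  The weight is \<open>x ^ p * (1 - x) powr (\<nu> - 1)\<close>, and the normalising factor \<open>1 / Gamma \<nu>\<close> turns the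
  moments \<open>Beta (p + m + 1) \<nu>\<close> into Gamma ratios.
\<close>

lemma frac_integral_disc_series:
  assumes F: "disc_series p \<gamma> F" and \<nu>: "\<nu> > 0" and z: "z \<in> unit_disc" "z \<noteq> 0"
  defines "\<psi> \<equiv> (\<lambda>k. Gamma (real k + 1) / Gamma (real k + 1 + \<nu>))"
  shows "frac_integral \<nu> F z =
     z powr of_real \<nu> * z ^ p * (\<Sum>m. of_real (\<psi> (p + m)) * (\<gamma> m * z ^ m))"
proof -
  have sm: "summable (\<lambda>m. norm (\<gamma> m * z ^ m))"
    using F z by (intro abs_summable_in_disc) (auto simp: disc_series_def)
  have \<psi>0: "\<psi> k > 0" for k
    unfolding \<psi>_def using \<nu> by (intro divide_pos_pos Gamma_real_pos) auto
  have \<psi>_mono: "\<psi> (p + m) \<le> \<psi> p" for m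
    using Gamma_ratio_antimono[OF \<nu>, of p "p + m"] unfolding \<psi>_def by linarith
  have sm': "summable (\<lambda>m. norm (of_real (\<psi> (p + m)) * (\<gamma> m * z ^ m)))"
    by (rule summable_bounded_multiplier[OF sm, where C = "\<psi> p"])
       (use \<psi>0 \<psi>_mono in \<open>simp add: abs_of_pos\<close>)
  have zz: "z / z powr of_real (1 - \<nu>) = z powr of_real \<nu>"
    using z by (simp add: powr_diff)
  have G: "Gamma \<nu> > 0" using \<nu> by (rule Gamma_real_pos)
  have "contour_integral (linepath 0 z) (\<lambda>\<zeta>. F \<zeta> / (z - \<zeta>) powr of_real (1 - \<nu>))
        = z powr of_real \<nu> * z ^ p *
          (\<Sum>m. of_real (Beta (real p + 1 + real m) \<nu>) * (\<gamma> m * z ^ m))"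
  proof (rule contour_integral_linepath_Beta_series)
    fix x :: real assume x: "x \<in> {0<..<1}"
    have xx: "x ^ p / (1 - x) powr (1 - \<nu>) = x powr (real p + 1 - 1) * (1 - x) powr (\<nu> - 1)"
      using x by (simp add: powr_diff powr_add powr_realpow)
    have "F (of_real x * z) = (of_real x * z) ^ p * (\<Sum>m. \<gamma> m * (of_real x * z) ^ m)"
      using F contraction_in_unit_disc[OF z(1) x] by (simp add: disc_series_def)
    moreover have "z - of_real x * z = of_real (1 - x) * z" by (simp add: algebra_simps)
    moreover have "(of_real (1 - x) * z) powr of_real (1 - \<nu>)
                   = of_real ((1 - x) powr (1 - \<nu>)) * z powr of_real (1 - \<nu>)"
      using x by (intro of_real_mult_powr) simp
    ultimately have "F (of_real x * z) / (z - of_real x * z) powr of_real (1 - \<nu>) * z =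
       of_real (x ^ p / (1 - x) powr (1 - \<nu>)) * ((z / z powr of_real (1 - \<nu>)) * z ^ p *
         (\<Sum>m. \<gamma> m * (of_real x * z) ^ m))"
      by (simp add: power_mult_distrib mult_ac del: of_real_diff)
    then show "F (of_real x * z) / (z - of_real x * z) powr of_real (1 - \<nu>) * z =
       z powr of_real \<nu> * z ^ p * (of_real (x powr (real p + 1 - 1) * (1 - x) powr (\<nu> - 1)) *
         (\<Sum>m. \<gamma> m * z ^ m * of_real x ^ m))"
      unfolding xx zz by (simp add: power_mult_distrib mult_ac)
  qed (use \<nu> sm in auto)
  also have "(\<lambda>m. Beta (real p + 1 + real m) \<nu>) = (\<lambda>m. Gamma \<nu> * \<psi> (p + m))"
    by (simp add: Beta_def \<psi>_def mult_ac add_ac)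
  also have "(\<Sum>m. of_real (Gamma \<nu> * \<psi> (p + m)) * (\<gamma> m * z ^ m))
           = of_real (Gamma \<nu>) * (\<Sum>m. of_real (\<psi> (p + m)) * (\<gamma> m * z ^ m))"
    by (subst suminf_mult[OF summable_norm_cancel[OF sm'], symmetric]) (simp add: mult_ac)
  finally have eq: "contour_integral (linepath 0 z) (\<lambda>\<zeta>. F \<zeta> / (z - \<zeta>) powr of_real (1 - \<nu>))
      = z powr of_real \<nu> * z ^ p *
        (of_real (Gamma \<nu>) * (\<Sum>m. of_real (\<psi> (p + m)) * (\<gamma> m * z ^ m)))" .
  show ?thesis
    unfolding frac_integral_def eq using G by simp
qed

section \<open>The multiplier operator on power series\<close>

lemma image_add_right_atLeast: "(\<lambda>m. m + p) ` {n..} = {n + p..}" for n p :: nat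
  using image_add_atLeast[of p n] by (simp add: add.commute)

lemma disc_series_of_has_sum:
  assumes n: "n \<ge> 1"
    and hs: "\<And>z. z \<in> unit_disc \<Longrightarrow> ((\<lambda>k. a k * z ^ k) has_sum (f z - z ^ p)) {n + p..}"
  shows "disc_series p (\<lambda>m. if m = 0 then 1 else if m < n then 0 else a (m + p)) f"
  unfolding disc_series_def
proof (rule ballI)
  fix z :: complex assume z: "z \<in> unit_disc"
  let ?\<beta> = "\<lambda>m. if m = 0 then 1 else if m < n then 0 else a (m + p)"
  have "(\<lambda>m. ?\<beta> m * z ^ m) sums (f z / z ^ p) \<and> f z = z ^ p * (f z / z ^ p)" if "z \<noteq> 0"
  proof
    have "((\<lambda>k. a k * z ^ k) has_sum (f z - z ^ p)) ((\<lambda>m. m + p) ` {n..})"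
      using hs[OF z] by (simp add: image_add_right_atLeast)
    then have "((\<lambda>m. a (m + p) * z ^ (m + p)) has_sum (f z - z ^ p)) {n..}"
      by (subst (asm) has_sum_reindex) (auto simp: inj_on_def o_def)
    then have "((\<lambda>m. inverse (z ^ p) * (a (m + p) * z ^ (m + p))) has_sum (inverse (z ^ p) * (f z - z ^ p))) {n..}"
      by (rule has_sum_cmult_right)
    also have "inverse (z ^ p) * (f z - z ^ p) = f z / z ^ p - 1"
      using that by (simp add: field_simps)
    also have "((\<lambda>m. inverse (z ^ p) * (a (m + p) * z ^ (m + p))) has_sum (f z / z ^ p - 1)) {n..}
        \<longleftrightarrow> ((\<lambda>m. ?\<beta> m * z ^ m - (if m = 0 then 1 else 0)) has_sum (f z / z ^ p - 1)) UNIV"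
      by (rule has_sum_cong_neutral) (use n that in \<open>auto simp: power_add not_le\<close>)
    finally have "(\<lambda>m. ?\<beta> m * z ^ m - (if m = 0 then 1 else 0)) sums (f z / z ^ p - 1)"
      by (rule has_sum_imp_sums)
    from sums_add[OF this sums_single[of 0 "\<lambda>_. 1"]]
    show "(\<lambda>m. ?\<beta> m * z ^ m) sums (f z / z ^ p)" by simp
  qed (use that in simp)
  moreover have "f z = z ^ p \<and> (\<lambda>m. ?\<beta> m * z ^ m) sums 1" if "z = 0"
  proof
    have "((\<lambda>k. a k * z ^ k) has_sum 0) {n + p..}"
      by (rule has_sum_0) (use that n in \<open>auto simp: zero_power\<close>)
    with hs[OF z] have "f z - z ^ p = 0" by (rule has_sum_unique)
    then show "f z = z ^ p" by simp
    have "(\<lambda>m. ?\<beta> m * 0 ^ m) sums ?\<beta> 0" by (rule powser_sums_zero)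
    then show "(\<lambda>m. ?\<beta> m * z ^ m) sums 1" using that by simp
  qed
  ultimately show "summable (\<lambda>m. ?\<beta> m * z ^ m) \<and> f z = z ^ p * (\<Sum>m. ?\<beta> m * z ^ m)"
    by (cases "z = 0") (auto simp: sums_iff)
qed

lemma disc_series_imp_fps_expansion_nth:
  assumes "disc_series p \<beta> f" and "k \<ge> p"
  shows "fps_nth (fps_expansion f 0) k = \<beta> (k - p)"
proof -
  have "conv_radius \<beta> \<ge> norm (1 / 2 :: complex)"
    by (rule conv_radius_geI) (use assms in \<open>auto simp: disc_series_def\<close>)
  then have rad: "fps_conv_radius (Abs_fps \<beta>) > 0"
    unfolding fps_conv_radius_def by (simp add: less_le_trans[of 0 "ereal (1/2)"])
  have "(\<lambda>z. z ^ p * eval_fps (Abs_fps \<beta>) z) has_fps_expansion fps_X ^ p * Abs_fps \<beta>"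
    by (intro fps_expansion_intros eval_fps_has_fps_expansion rad)
  moreover have "eventually (\<lambda>z. z ^ p * eval_fps (Abs_fps \<beta>) z = f z) (nhds 0)"
    using eventually_nhds_in_open[of unit_disc 0]
    by (rule eventually_mono[rotated 2]) (use assms in \<open>auto simp: disc_series_def eval_fps_def\<close>)
  ultimately have "f has_fps_expansion fps_X ^ p * Abs_fps \<beta>"
    by (subst (asm) has_fps_expansion_cong[OF _ refl])
  then have "fps_expansion f 0 = fps_X ^ p * Abs_fps \<beta>"
    by (rule fps_expansion_eqI)
  then show ?thesis
    using assms(2) by (simp add: fps_X_power_mult_nth)
qed

lemma Phi_at_degree:
  assumes "p \<ge> 1" "0 \<le> l"
  shows "Phi p \<delta> lam \<mu> l p = 1"
  using assms by (simp add: Phi_def)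

text \<open>
  Since \<open>lam \<ge> \<mu> \<ge> 0\<close>, the base of the power is, up to the factor \<open>1 / (p + l)\<close>, a product of two
  nonnegative nondecreasing factors of \<open>k\<close> plus a constant, as soon as \<open>k \<ge> p\<close>.
\<close>

lemma Phi_mono:
  assumes "p \<ge> 1" "\<mu> \<le> lam" "0 \<le> \<mu>" "0 \<le> l" "0 \<le> \<delta>" "p \<le> i" "i \<le> j"
  shows "Phi p \<delta> lam \<mu> l i \<le> Phi p \<delta> lam \<mu> l j"
proof -
  have "(real i - real p) * (lam * \<mu> * real i + lam - \<mu>) \<le> (real j - real p) * (lam * \<mu> * real j + lam - \<mu>)"
    using assms by (intro mult_mono) (auto intro!: mult_left_mono add_nonneg_nonneg simp: add_diff_eq[symmetric])
  moreover have "0 \<le> (real i - real p) * (lam * \<mu> * real i + lam - \<mu>)"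
    using assms by (intro mult_nonneg_nonneg) (auto simp: add_diff_eq[symmetric])
  ultimately show ?thesis
    unfolding Phi_def using assms by (intro powr_mono2 divide_right_mono) auto
qed

lemma Phi_ge_1:
  assumes "p \<ge> 1" "\<mu> \<le> lam" "0 \<le> \<mu>" "0 \<le> l" "0 \<le> \<delta>" "p \<le> k"
  shows "1 \<le> Phi p \<delta> lam \<mu> l k"
  using Phi_mono[of p \<mu> lam l \<delta> p k] Phi_at_degree[of p l] assms by simp

text \<open>
  The multiplier grows at most like \<open>m powr (2 * \<delta>)\<close>. Hence it cannot spoil convergence of a power
  series in the open disc, and the sum that defines \<open>J_op\<close> is a genuine one.
\<close>

lemma Phi_times_geometric_bounded:
  assumes "p \<ge> 1" "\<mu> \<le> lam" "0 \<le> \<mu>" "0 \<le> l" "0 \<le> \<delta>" and q: "0 < q" "q < 1"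
  obtains C where "\<And>m. \<bar>Phi p \<delta> lam \<mu> l (m + p) * q ^ m\<bar> \<le> C"
proof -
  define K where "K = 1 + lam * \<mu> * (1 + real p) + lam"
  have K: "K > 0" using assms by (auto simp: K_def intro!: add_pos_nonneg)
  have bound: "Phi p \<delta> lam \<mu> l (m + p) \<le> (K * (real m + 1) ^ 2) powr \<delta>" for m
    unfolding Phi_def
  proof (rule powr_mono2)
    let ?x = "(real (m + p) - real p) * (lam * \<mu> * real (m + p) + lam - \<mu>)"
    have x0: "0 \<le> ?x"
      using assms by (intro mult_nonneg_nonneg) (auto simp: add_diff_eq[symmetric])
    have pl: "real p + l \<ge> 1" using assms by simp
    show "0 \<le> (?x + real p + l) / (real p + l)" using x0 pl by simp
    have "?x \<le> (real m + 1) * ((lam * \<mu> * (1 + real p) + lam) * (real m + 1))"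
    proof (rule mult_mono)
      have "lam * \<mu> * real (m + p) \<le> lam * \<mu> * ((1 + real p) * (real m + 1))"
        using assms by (intro mult_left_mono) (auto simp: algebra_simps)
      moreover have "lam \<le> lam * (real m + 1)" using assms by (simp add: algebra_simps)
      ultimately show "lam * \<mu> * real (m + p) + lam - \<mu> \<le> (lam * \<mu> * (1 + real p) + lam) * (real m + 1)"
        using assms by (simp add: algebra_simps)
    qed (use assms in \<open>auto simp: add_diff_eq[symmetric]\<close>)
    also have "\<dots> = (K - 1) * (real m + 1) ^ 2"
      by (simp add: K_def power2_eq_square)
    finally have x1: "?x \<le> (K - 1) * (real m + 1) ^ 2" .
    have m1: "1 \<le> (real m + 1) ^ 2" by simp
    have "(?x + real p + l) / (real p + l) = ?x / (real p + l) + 1"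
      using pl by (simp add: field_simps)
    also have "?x / (real p + l) \<le> ?x / 1"
      using x0 pl by (intro divide_left_mono) auto
    also have "?x / 1 + 1 \<le> (K - 1) * (real m + 1) ^ 2 + (real m + 1) ^ 2"
      using add_mono[OF x1 m1] by (simp only: div_by_1)
    finally show "(?x + real p + l) / (real p + l) \<le> K * (real m + 1) ^ 2"
      by (simp add: algebra_simps)
  qed (use assms in auto)
  have "(\<lambda>m. (K * (real m + 1) ^ 2) powr \<delta> * q ^ m) \<longlonglongrightarrow> 0"
    using K q \<open>0 \<le> \<delta>\<close> by real_asymp
  then have "Bseq (\<lambda>m. (K * (real m + 1) ^ 2) powr \<delta> * q ^ m)"
    by (intro convergent_imp_Bseq convergentI)
  then obtain C where C: "\<And>m. norm ((K * (real m + 1) ^ 2) powr \<delta> * q ^ m) \<le> C"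
    by (elim BseqE) blast
  have "\<bar>Phi p \<delta> lam \<mu> l (m + p) * q ^ m\<bar> \<le> C" for m
  proof -
    have "0 \<le> Phi p \<delta> lam \<mu> l (m + p) * q ^ m" using q by (simp add: Phi_def)
    moreover have "Phi p \<delta> lam \<mu> l (m + p) * q ^ m \<le> (K * (real m + 1) ^ 2) powr \<delta> * q ^ m"
      using bound q by (intro mult_right_mono) auto
    ultimately show ?thesis using C[of m] by simp
  qed
  then show ?thesis by (rule that)
qed

lemma J_op_disc_series:
  assumes par: "p \<ge> 1" "\<mu> \<le> lam" "0 \<le> \<mu>" "0 \<le> l" "0 \<le> \<delta>"
    and f: "disc_series p \<beta> f" and \<beta>0: "\<beta> 0 = 1" and gap: "\<And>m. 0 < m \<Longrightarrow> m < n \<Longrightarrow> \<beta> m = 0"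
    and n: "n \<ge> 1"
  shows "disc_series p (\<lambda>m. of_real (Phi p \<delta> lam \<mu> l (m + p)) * \<beta> m) (J_op n p \<delta> lam \<mu> l f)"
  unfolding disc_series_def
proof (intro ballI conjI)
  fix z :: complex assume z: "z \<in> unit_disc"
  let ?\<Phi> = "\<lambda>k. Phi p \<delta> lam \<mu> l k"
  let ?t = "\<lambda>m. of_real (?\<Phi> (m + p)) * \<beta> m * z ^ m"
  have abs: "summable (\<lambda>m. norm (?t m))"
  proof -
    define s where "s = (1 + norm z) / 2"
    have s: "0 < s" "s < 1" "norm z < s"
      using z norm_ge_zero[of z] by (auto simp: s_def simp del: norm_ge_zero)
    have "norm z / s < 1" using s by simp
    then obtain q where "norm z / s < q" "q < 1" using dense by blast
    moreover have "0 \<le> norm z / s" using s by simp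
    ultimately have q: "0 < q" "q < 1" "norm z / s < q" by linarith+
    obtain C where C: "\<And>m. \<bar>?\<Phi> (m + p) * q ^ m\<bar> \<le> C"
      using Phi_times_geometric_bounded[OF par q(1,2)] by blast
    \<comment> \<open>Compare with the series of absolute values at the larger radius \<open>s\<close>; the growth of the multiplier is absorbed by \<open>q ^ m\<close>, where \<open>norm z < q * s\<close>.\<close>
    have "summable (\<lambda>m. norm (\<beta> m * of_real s ^ m))"
      using f s by (intro abs_summable_in_disc) (auto simp: disc_series_def)
    then have sm: "summable (\<lambda>m. C * norm (\<beta> m * of_real s ^ m))"
      by (rule summable_mult)
    show ?thesis
    proof (rule summable_comparison_test'[OF sm])
      fix m :: nat
      have "norm z \<le> q * s" using q s by (simp add: field_simps)
      then have "norm z ^ m \<le> q ^ m * s ^ m"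
        by (metis norm_ge_zero power_mono power_mult_distrib)
      then have "norm (?t m) \<le> \<bar>?\<Phi> (m + p)\<bar> * norm (\<beta> m) * (q ^ m * s ^ m)"
        by (simp add: norm_mult norm_power mult_left_mono)
      also have "\<dots> = \<bar>?\<Phi> (m + p) * q ^ m\<bar> * norm (\<beta> m * of_real s ^ m)"
        using q s by (simp add: norm_mult norm_power abs_mult)
      also have "\<dots> \<le> C * norm (\<beta> m * of_real s ^ m)"
        by (intro mult_right_mono C) auto
      finally show "norm (norm (?t m)) \<le> C * norm (\<beta> m * of_real s ^ m)" by simp
    qed
  qed
  show sm: "summable ?t" using abs by (rule summable_norm_cancel)
  have "(?t has_sum (\<Sum>m. ?t m)) UNIV"
    using abs sm by (intro norm_summable_imp_has_sum summable_sums)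
  then have "(?t has_sum ((\<Sum>m. ?t m) - (\<Sum>m\<in>{0}. ?t m))) (UNIV - {0})"
    by (intro has_sum_Diff has_sum_finite) auto
  also have "(\<Sum>m\<in>{0}. ?t m) = 1"
    using \<beta>0 Phi_at_degree[of p l] par by simp
  also have "(?t has_sum ((\<Sum>m. ?t m) - 1)) (UNIV - {0}) \<longleftrightarrow> (?t has_sum ((\<Sum>m. ?t m) - 1)) {n..}"
    by (rule has_sum_cong_neutral) (use gap n in auto)
  finally have "((\<lambda>m. z ^ p * ?t m) has_sum (z ^ p * ((\<Sum>m. ?t m) - 1))) {n..}"
    by (rule has_sum_cmult_right)
  also have "(\<lambda>m. z ^ p * ?t m) =
      (\<lambda>k. of_real (?\<Phi> k) * fps_nth (fps_expansion f 0) k * z ^ k) \<circ> (\<lambda>m. m + p)"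
    using disc_series_imp_fps_expansion_nth[OF f] by (auto simp: fun_eq_iff power_add)
  finally have "((\<lambda>k. of_real (?\<Phi> k) * fps_nth (fps_expansion f 0) k * z ^ k)
      has_sum (z ^ p * ((\<Sum>m. ?t m) - 1))) ((\<lambda>m. m + p) ` {n..})"
    by (subst has_sum_reindex) (auto simp: inj_on_def o_def)
  then have "((\<lambda>k. of_real (?\<Phi> k) * fps_nth (fps_expansion f 0) k * z ^ k)
      has_sum (z ^ p * ((\<Sum>m. ?t m) - 1))) {n + p..}"
    by (simp add: image_add_right_atLeast)
  then show "J_op n p \<delta> lam \<mu> l f z = z ^ p * (\<Sum>m. ?t m)"
    unfolding J_op_def by (simp add: infsumI algebra_simps)
qed

text \<open>
  If \<open>J u = u ^ p * H u\<close> then \<open>deriv J u / u ^ (p - 1) = p * H u + u * deriv H u\<close> off the origin, and the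
  right-hand side is the analytic extension.
\<close>

lemma remove_sings_deriv_disc_series:
  assumes J: "disc_series p \<gamma> J" and p: "p \<ge> 1" and z: "z \<in> unit_disc"
  shows "(\<lambda>m. of_nat (p + m) * \<gamma> m * z ^ m) sums remove_sings (\<lambda>u. deriv J u / u ^ (p - 1)) z"
proof -
  define H where "H = (\<lambda>u. \<Sum>m. \<gamma> m * u ^ m)"
  define D where "D = (\<lambda>u. \<Sum>m. diffs \<gamma> m * u ^ m)"
  define P where "P = (\<lambda>u. of_nat p * H u + u * D u)"
  have sm: "summable (\<lambda>m. \<gamma> m * u ^ m)" if "norm u < 1" for u
    using J that by (auto simp: disc_series_def)
  have sums: "(\<lambda>m. of_nat (p + m) * \<gamma> m * u ^ m) sums P u" if u: "norm u < 1" for u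
  proof -
    have "summable (\<lambda>m. diffs \<gamma> m * u ^ m)"
      using u sm by (rule termdiff_converges)
    then have "(\<lambda>m. of_nat m * \<gamma> m * u ^ (m - Suc 0)) sums D u"
      unfolding D_def by (rule diffs_equiv)
    then have "(\<lambda>m. u * (of_nat m * \<gamma> m * u ^ (m - Suc 0))) sums (u * D u)"
      by (rule sums_mult)
    also have "(\<lambda>m. u * (of_nat m * \<gamma> m * u ^ (m - Suc 0))) = (\<lambda>m. of_nat m * \<gamma> m * u ^ m)"
    proof
      fix m show "u * (of_nat m * \<gamma> m * u ^ (m - Suc 0)) = of_nat m * \<gamma> m * u ^ m"
        by (cases m) auto
    qed
    finally have "(\<lambda>m. of_nat m * \<gamma> m * u ^ m) sums (u * D u)" .
    moreover have "(\<lambda>m. of_nat p * (\<gamma> m * u ^ m)) sums (of_nat p * H u)"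
      unfolding H_def using sm[OF u] by (intro sums_mult summable_sums)
    ultimately have "(\<lambda>m. of_nat p * (\<gamma> m * u ^ m) + of_nat m * \<gamma> m * u ^ m) sums P u"
      unfolding P_def by (intro sums_add)
    then show ?thesis by (simp add: algebra_simps)
  qed
  have quot: "deriv J u / u ^ (p - 1) = P u" if u: "norm u < 1" "u \<noteq> 0" for u
  proof -
    have "(H has_field_derivative D u) (at u)"
      unfolding H_def D_def using sm u(1) by (rule termdiffs_strong')
    then have "((\<lambda>u. u ^ p * H u) has_field_derivative of_nat p * u ^ (p - 1) * H u + u ^ p * D u) (at u)"
      by (auto intro!: derivative_eq_intros)
    moreover have "eventually (\<lambda>u. u ^ p * H u = J u) (nhds u)"
      using eventually_nhds_in_open[of unit_disc u]
      by (rule eventually_mono[rotated 2]) (use J u in \<open>auto simp: disc_series_def H_def\<close>)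
    ultimately have "(J has_field_derivative of_nat p * u ^ (p - 1) * H u + u ^ p * D u) (at u)"
      by (simp add: DERIV_cong_ev)
    then have "deriv J u = of_nat p * u ^ (p - 1) * H u + u ^ p * D u"
      by (rule DERIV_imp_deriv)
    moreover have "u ^ p = u ^ (p - 1) * u"
      using p by (simp flip: power_Suc2)
    ultimately show ?thesis
      using u by (simp add: P_def field_simps)
  qed
  have "P holomorphic_on ball 0 1"
    by (rule power_series_holomorphic[of 0 1 "\<lambda>m. of_nat (p + m) * \<gamma> m"]) (use sums in auto)
  then have "isCont P z"
    using z by (metis continuous_on_eq_continuous_at holomorphic_on_imp_continuous_on open_ball)
  then have "P \<midarrow>z\<rightarrow> P z" by (simp add: isCont_def)
  moreover have "eventually (\<lambda>u. P u = deriv J u / u ^ (p - 1)) (at z)"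
  proof -
    have "open (unit_disc - ({0} - {z}))" "z \<in> unit_disc - ({0} - {z})"
      using z by (auto intro!: open_Diff finite_imp_closed)
    then have "eventually (\<lambda>u. u \<in> unit_disc - ({0} - {z}) - {z}) (at z)"
      by (rule eventually_at_in_open)
    then show ?thesis
      by (rule eventually_mono) (auto simp: quot[unfolded One_nat_def])
  qed
  ultimately have "(\<lambda>u. deriv J u / u ^ (p - 1)) \<midarrow>z\<rightarrow> P z"
    by (rule Lim_transform_eventually)
  then have "remove_sings (\<lambda>u. deriv J u / u ^ (p - 1)) z = P z"
    by (rule remove_sings_eqI)
  with sums[of z] z show ?thesis by simp
qed

section \<open>Coefficient inequality and distortion bounds\<close>

text \<open>
  The difference of the two values of the Moebius map at \<open>w\<close> and at 1 is
  \<open>(B - A) / (1 + B) * ((1 - w) / (1 + B * w))\<close>. The real part of the last factor has the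
  sign of \<open>(1 - Re w) - B * (\<bar>w\<bar>^2 - Re w) \<ge> (1 - B) * (1 - Re w) \<ge> 0\<close>.
\<close>

lemma Re_Moebius_ge:
  fixes w :: complex
  assumes "norm w < 1" "- 1 \<le> A" "A < B" "B \<le> 1" "0 < B"
  shows "(1 + A) / (1 + B) \<le> Re ((1 + of_real A * w) / (1 + of_real B * w))"
proof -
  have "norm (of_real B * w) < 1"
    using assms mult_le_one[of B "norm w"] by (auto simp: norm_mult intro: le_less_trans[OF mult_left_le_one_le])
  then have nz: "1 + of_real B * w \<noteq> 0"
    by (metis add.commute add_eq_0_iff norm_minus_cancel norm_one less_irrefl)
  have nz': "1 + of_real B \<noteq> (0::complex)"
    using assms by (simp add: complex_eq_iff)
  have "(1 + of_real A * w) / (1 + of_real B * w) - (1 + of_real A) / (1 + of_real B)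
      = of_real ((B - A) / (1 + B)) * ((1 - w) / (1 + of_real B * w))"
    using nz nz' by (simp add: divide_simps) (simp add: algebra_simps)
  then have "Re ((1 + of_real A * w) / (1 + of_real B * w)) - (1 + A) / (1 + B)
      = (B - A) / (1 + B) * Re ((1 - w) / (1 + of_real B * w))"
    by (metis (no_types, lifting) Re_complex_of_real Re_divide_of_real minus_complex.sel(1) of_real_1 of_real_add of_real_divide times_complex.sel(1) Im_complex_of_real mult_zero_left diff_zero)
  moreover have "0 \<le> Re ((1 - w) / (1 + of_real B * w))"
  proof -
    define x where "x = Re w"
    define q where "q = (Re w)\<^sup>2 + (Im w)\<^sup>2"
    have "norm w ^ 2 \<le> 1" using assms(1) by (simp add: abs_square_le_1)
    then have q1: "q \<le> 1" by (simp add: q_def cmod_power2)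
    have "x \<le> 1" using assms(1) complex_Re_le_cmod[of w] by (simp add: x_def)
    have "Re (1 - w) * Re (1 + of_real B * w) + Im (1 - w) * Im (1 + of_real B * w) = (1 - x) - B * (q - x)"
      by (simp add: x_def q_def power2_eq_square algebra_simps)
    moreover have "B * (q - x) \<le> B * (1 - x)" using q1 assms by (intro mult_left_mono) auto
    moreover have "B * (1 - x) \<le> 1 * (1 - x)" using \<open>x \<le> 1\<close> assms by (intro mult_right_mono) auto
    ultimately show ?thesis
      by (subst Re_divide, intro divide_nonneg_nonneg) (auto simp del: minus_complex.sel plus_complex.sel)
  qed
  moreover have "0 \<le> (B - A) / (1 + B)" using assms by simp
  ultimately have "0 \<le> Re ((1 + of_real A * w) / (1 + of_real B * w)) - (1 + A) / (1 + B)"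
    using mult_nonneg_nonneg by metis
  then show ?thesis by linarith
qed

text \<open>
  The one inequality on which the distortion bounds rest. On the segment \<open>0 < r < 1\<close> the subordinate
  function is \<open>1\<close> minus a series with nonnegative terms, and subordination keeps its real part at
  least \<open>(1 + A) / (1 + B)\<close>. Every partial sum of that series is therefore bounded by a constant
  independent of \<open>r\<close>, and \<open>r\<close> may tend to 1 in a finite sum.
\<close>

lemma class_P_tilde_coefficients:
  assumes par: "p \<ge> 1" "\<mu> \<le> lam" "0 \<le> \<mu>" "0 \<le> l" "0 \<le> \<delta>" and n: "n \<ge> 1"
    and AB: "- 1 \<le> A" "A < B" "B \<le> 1" "0 < B" and \<sigma>: "\<sigma> < real p"
    and f: "f \<in> class_P_tilde n p \<delta> lam \<mu> l A B \<sigma>"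
  obtains e :: "nat \<Rightarrow> real" where
    "\<And>m. 0 \<le> e m" "\<And>m. m < n \<Longrightarrow> e m = 0"
    "disc_series p (\<lambda>m. if m = 0 then 1 else - of_real (e m)) f"
    "\<And>N. (\<Sum>m<N. real (p + m) * Phi p \<delta> lam \<mu> l (m + p) * e m) \<le> (real p - \<sigma>) * (B - A) / (1 + B)"
proof -
  from f obtain a :: "nat \<Rightarrow> complex" where
    a: "\<And>z. z \<in> unit_disc \<Longrightarrow> ((\<lambda>k. of_real (norm (a k)) * z ^ k) has_sum (z ^ p - f z)) {n + p..}"
    unfolding class_P_tilde_def by blast
  define e where "e = (\<lambda>m. if m < n then 0 else norm (a (m + p)))"
  define \<beta> where "\<beta> = (\<lambda>m. if m = 0 then 1 else - e m)"
  have e0: "e m \<ge> 0" and egap: "m < n \<Longrightarrow> e m = 0" for m by (auto simp: e_def)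
  have "((\<lambda>k. (- of_real (norm (a k))) * z ^ k) has_sum (f z - z ^ p)) {n + p..}" if "z \<in> unit_disc" for z
    using has_sum_uminusI[OF a[OF that]] by simp
  then have "disc_series p (\<lambda>m. if m = 0 then 1 else if m < n then 0 else - of_real (norm (a (m + p)))) f"
    by (rule disc_series_of_has_sum[OF n])
  also have "(\<lambda>m. if m = 0 then 1 else if m < n then 0 else - of_real (norm (a (m + p)))) = (\<lambda>m. of_real (\<beta> m) :: complex)"
    by (auto simp: e_def \<beta>_def fun_eq_iff)
  finally have fs: "disc_series p (\<lambda>m. of_real (\<beta> m)) f" .
  have Js: "disc_series p (\<lambda>m. of_real (Phi p \<delta> lam \<mu> l (m + p)) * of_real (\<beta> m)) (J_op n p \<delta> lam \<mu> l f)"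
    by (rule J_op_disc_series[OF par fs]) (use n egap in \<open>auto simp: \<beta>_def\<close>)
  define C where "C = (real p - \<sigma>) * (B - A) / (1 + B)"
  define \<kappa> where "\<kappa> = (\<lambda>m. real (p + m) * Phi p \<delta> lam \<mu> l (m + p))"
  have \<kappa>0: "\<kappa> m \<ge> 0" for m by (simp add: \<kappa>_def Phi_def)
  have radial: "(\<Sum>m<N. \<kappa> m * e m * r ^ m) \<le> C" if r: "0 < r" "r < 1" for N r
  proof -
    define R where "R = remove_sings (\<lambda>u. deriv (J_op n p \<delta> lam \<mu> l f) u / u ^ (p - 1)) (of_real r)"
    have rd: "of_real r \<in> unit_disc" using r by simp
    have "subordinate
       (\<lambda>z. 1 / (of_nat p - of_real \<sigma>) *
            (remove_sings (\<lambda>u. deriv (J_op n p \<delta> lam \<mu> l f) u / u ^ (p - 1)) z - of_real \<sigma>))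
       (\<lambda>z. (1 + of_real A * z) / (1 + of_real B * z))"
      using f by (simp add: class_P_tilde_def class_P_def)
    then obtain w where "\<forall>z\<in>unit_disc. norm (w z) < 1 \<and> 1 / (of_nat p - of_real \<sigma>) *
            (remove_sings (\<lambda>u. deriv (J_op n p \<delta> lam \<mu> l f) u / u ^ (p - 1)) z - of_real \<sigma>)
          = (1 + of_real A * w z) / (1 + of_real B * w z)"
      unfolding subordinate_def by blast
    from bspec[OF this rd] have w: "norm (w (of_real r)) < 1" and
      "1 / (of_nat p - of_real \<sigma>) * (R - of_real \<sigma>) =
         (1 + of_real A * w (of_real r)) / (1 + of_real B * w (of_real r))"
      unfolding R_def by auto
    then have "Re (1 / (of_nat p - of_real \<sigma>) * (R - of_real \<sigma>)) \<ge> (1 + A) / (1 + B)"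
      using Re_Moebius_ge[OF w AB] by simp
    also have "1 / (of_nat p - of_real \<sigma>) * (R - of_real \<sigma>) = (R - of_real \<sigma>) / of_real (real p - \<sigma>)"
      by simp
    also have "Re \<dots> = (Re R - \<sigma>) / (real p - \<sigma>)"
      by (simp only: Re_divide_of_real minus_complex.sel Re_complex_of_real)
    finally have ReR: "real p - Re R \<le> C"
      using \<sigma> AB unfolding C_def by (simp add: field_simps)
    have "(\<lambda>m. of_nat (p + m) * (of_real (Phi p \<delta> lam \<mu> l (m + p)) * of_real (\<beta> m)) * of_real r ^ m) sums R"
      unfolding R_def by (rule remove_sings_deriv_disc_series[OF Js par(1) rd])
    also have "(\<lambda>m. of_nat (p + m) * (of_real (Phi p \<delta> lam \<mu> l (m + p)) * of_real (\<beta> m)) * of_real r ^ m)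
        = (\<lambda>m. complex_of_real (\<kappa> m * \<beta> m * r ^ m))"
      by (simp add: \<kappa>_def mult.assoc)
    finally have "(\<lambda>m. \<kappa> m * \<beta> m * r ^ m) sums Re R"
      by (auto dest: sums_Re)
    from sums_diff[OF sums_single[of 0 "\<lambda>_. real p"] this]
    have "(\<lambda>m. (if m = 0 then real p else 0) - \<kappa> m * \<beta> m * r ^ m) sums (real p - Re R)" .
    also have "(\<lambda>m. (if m = 0 then real p else 0) - \<kappa> m * \<beta> m * r ^ m) = (\<lambda>m. \<kappa> m * e m * r ^ m)"
      using egap[of 0] n Phi_at_degree[of p l] par by (auto simp: \<beta>_def \<kappa>_def fun_eq_iff)
    finally have "(\<lambda>m. \<kappa> m * e m * r ^ m) sums (real p - Re R)" .
    then have "(\<Sum>m<N. \<kappa> m * e m * r ^ m) \<le> real p - Re R"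
      using sum_le_suminf[of "\<lambda>m. \<kappa> m * e m * r ^ m" "{..<N}"] \<kappa>0 e0 r by (simp add: sums_iff)
    with ReR show ?thesis by simp
  qed
  have "(\<Sum>m<N. \<kappa> m * e m) \<le> C" for N
  proof (rule tendsto_upperbound)
    have "((\<lambda>r. \<Sum>m<N. \<kappa> m * e m * r ^ m) \<longlongrightarrow> (\<Sum>m<N. \<kappa> m * e m * 1 ^ m)) (at_left 1)"
      by (intro tendsto_intros)
    then show "((\<lambda>r. \<Sum>m<N. \<kappa> m * e m * r ^ m) \<longlongrightarrow> (\<Sum>m<N. \<kappa> m * e m)) (at_left 1)"
      by simp
    have "eventually (\<lambda>r::real. r \<in> {0<..<1}) (at_left 1)"
      by (rule eventually_at_left_real) simp
    then show "eventually (\<lambda>r. (\<Sum>m<N. \<kappa> m * e m * r ^ m) \<le> C) (at_left 1)"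
      by (rule eventually_mono) (use radial in auto)
  qed simp
  moreover have "(\<lambda>m. of_real (\<beta> m)) = (\<lambda>m. if m = 0 then 1 else - complex_of_real (e m))"
    by (auto simp: \<beta>_def)
  ultimately show ?thesis
    using that[of e] e0 egap fs unfolding \<kappa>_def C_def by simp
qed

text \<open>
  The multiplier of the coefficient of index \<open>m\<close> under the composition of the two integral operators.
\<close>

definition op_weight :: "real \<Rightarrow> real \<Rightarrow> nat \<Rightarrow> nat \<Rightarrow> real" where
  "op_weight \<nu> \<theta> p m =
     (\<theta> + real p) / (\<theta> + real p + real m) * (Gamma (real (p + m) + 1) / Gamma (real (p + m) + 1 + \<nu>))"

lemma op_weight_pos:
  assumes "- real p < \<theta>" "0 < \<nu>"
  shows "0 < op_weight \<nu> \<theta> p m"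
  unfolding op_weight_def using assms by (intro mult_pos_pos divide_pos_pos Gamma_real_pos) auto

lemma op_weight_antimono:
  assumes "- real p < \<theta>" "0 < \<nu>" "i \<le> j"
  shows "op_weight \<nu> \<theta> p j \<le> op_weight \<nu> \<theta> p i"
  unfolding op_weight_def
proof (rule mult_mono)
  show "Gamma (real (p + j) + 1) / Gamma (real (p + j) + 1 + \<nu>)
      \<le> Gamma (real (p + i) + 1) / Gamma (real (p + i) + 1 + \<nu>)"
    using assms by (intro Gamma_ratio_antimono) auto
  show "0 \<le> Gamma (real (p + j) + 1) / Gamma (real (p + j) + 1 + \<nu>)"
    using assms by (intro divide_nonneg_nonneg less_imp_le[OF Gamma_real_pos]) auto
qed (use assms in \<open>auto intro!: divide_left_mono\<close>)

lemma frac_integral_I_op_disc_series: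
  assumes f: "disc_series p \<beta> f" and "p \<ge> 1" "- real p < \<theta>" "0 < \<nu>"
    and z: "z \<in> unit_disc" "z \<noteq> 0"
  shows "norm (frac_integral \<nu> (I_op \<theta> p f) z) =
     norm z powr (real p + \<nu>) * norm (\<Sum>m. of_real (op_weight \<nu> \<theta> p m) * (\<beta> m * z ^ m))"
proof -
  have "frac_integral \<nu> (I_op \<theta> p f) z =
     z powr of_real \<nu> * z ^ p * (\<Sum>m. of_real (op_weight \<nu> \<theta> p m) * (\<beta> m * z ^ m))"
    using frac_integral_disc_series[OF I_op_disc_series[OF assms(1-3)] assms(4) z]
    by (simp add: op_weight_def mult_ac)
  moreover have "norm (z powr of_real \<nu> * z ^ p) = norm z powr (real p + \<nu>)"
    using z by (simp add: norm_mult norm_power norm_powr_real_powr' powr_add powr_realpow mult.commute)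
  ultimately show ?thesis by (simp add: norm_mult)
qed

lemma frac_integral_at_0: "frac_integral \<nu> F 0 = 0"
  by (simp add: frac_integral_def)

lemma bound_coeff_eq:
  "bound_coeff n p \<delta> lam \<mu> l A B \<sigma> \<nu> \<theta> =
     op_weight \<nu> \<theta> p n * ((real p - \<sigma>) * (B - A) / (1 + B) / (real (p + n) * Phi p \<delta> lam \<mu> l (n + p)))"
  by (simp add: bound_coeff_def op_weight_def add_ac mult_ac)

text \<open>
  The weights decrease and the multipliers \<open>(p + m) * Phi p \<delta> lam \<mu> l (m + p)\<close> increase, so a series
  with coefficients \<open>e m\<close>, \<open>m \<ge> n\<close>, is largest when the whole mass allowed by the coefficient
  inequality sits at the first index \<open>n\<close>. The triangle inequality against the leading term does the rest.
\<close>

lemma distortion_bounds: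
  assumes par: "p \<ge> 1" "\<mu> \<le> lam" "0 \<le> \<mu>" "0 \<le> l" "0 \<le> \<delta>" and n: "n \<ge> 1"
    and AB: "- 1 \<le> A" "A < B" "B \<le> 1" "0 < B" and \<sigma>: "\<sigma> < real p"
    and \<nu>\<theta>: "0 < \<nu>" "- real p < \<theta>"
    and f: "f \<in> class_P_tilde n p \<delta> lam \<mu> l A B \<sigma>" and z: "z \<in> unit_disc"
  shows "lower_bound n p \<delta> lam \<mu> l A B \<sigma> \<nu> \<theta> z \<le> norm (frac_integral \<nu> (I_op \<theta> p f) z)"
    and "norm (frac_integral \<nu> (I_op \<theta> p f) z) \<le> upper_bound n p \<delta> lam \<mu> l A B \<sigma> \<nu> \<theta> z"
proof -
  let ?W = "op_weight \<nu> \<theta> p"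
  let ?c = "bound_coeff n p \<delta> lam \<mu> l A B \<sigma> \<nu> \<theta>"
  have W0: "?W 0 = Gamma (real p + 1) / Gamma (real p + 1 + \<nu>)"
    using \<nu>\<theta> by (simp add: op_weight_def)
  have "(?W 0 - ?c * norm z ^ n) * norm z powr (real p + \<nu>) \<le> norm (frac_integral \<nu> (I_op \<theta> p f) z) \<and>
        norm (frac_integral \<nu> (I_op \<theta> p f) z) \<le> (?W 0 + ?c * norm z ^ n) * norm z powr (real p + \<nu>)"
  proof (cases "z = 0")
    case True
    then show ?thesis by (simp add: frac_integral_at_0)
  next
    case False
    obtain e :: "nat \<Rightarrow> real" where
      e0: "\<And>m. 0 \<le> e m" and egap: "\<And>m. m < n \<Longrightarrow> e m = 0" and
      fs: "disc_series p (\<lambda>m. if m = 0 then 1 else - of_real (e m)) f" and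
      coeff: "\<And>N. (\<Sum>m<N. real (p + m) * Phi p \<delta> lam \<mu> l (m + p) * e m) \<le> (real p - \<sigma>) * (B - A) / (1 + B)"
      using class_P_tilde_coefficients[OF par n AB \<sigma> f] by blast
    define \<kappa> where "\<kappa> = real (p + n) * Phi p \<delta> lam \<mu> l (n + p)"
    have \<kappa>: "\<kappa> > 0"
      using Phi_ge_1[OF par, of "n + p"] par(1) by (simp add: \<kappa>_def)
    define E where "E = (real p - \<sigma>) * (B - A) / (1 + B) / \<kappa>"
    \<comment> \<open>Replacing each multiplier by the smallest one, \<open>\<kappa>\<close>, turns the weighted inequality into a bound for the plain sum.\<close>
    have partial: "(\<Sum>m<N. e m) \<le> E" for N
    proof -
      have "\<kappa> * (\<Sum>m<N. e m) \<le> (\<Sum>m<N. real (p + m) * Phi p \<delta> lam \<mu> l (m + p) * e m)"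
        unfolding sum_distrib_left
      proof (rule sum_mono)
        fix m
        show "\<kappa> * e m \<le> real (p + m) * Phi p \<delta> lam \<mu> l (m + p) * e m"
        proof (cases "m < n")
          case False
          then show ?thesis
            unfolding \<kappa>_def using e0[of m] Phi_mono[OF par, of "n + p" "m + p"]
            by (intro mult_right_mono mult_mono) (auto simp: Phi_def)
        qed (simp add: egap)
      qed
      also note coeff
      finally show ?thesis
        unfolding E_def pos_le_divide_eq[OF \<kappa>] by (simp only: mult.commute)
    qed
    have esm: "summable e" by (rule summableI_nonneg_bounded[OF e0 partial])
    have eE: "suminf e \<le> E" by (rule suminf_le_const[OF esm partial])
    let ?R = "\<lambda>m. of_real (?W m * e m) * z ^ m"
    have Rbound: "norm (?R m) \<le> ?W n * norm z ^ n * e m" for m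
    proof (cases "m < n")
      case False
      have "?W m * norm z ^ m \<le> ?W n * norm z ^ n"
        using False z op_weight_antimono[OF \<nu>\<theta>(2,1), of n m] op_weight_pos[OF \<nu>\<theta>(2,1), of n]
        by (intro mult_mono power_decreasing) auto
      then have "?W m * norm z ^ m * e m \<le> ?W n * norm z ^ n * e m"
        by (rule mult_right_mono[OF _ e0])
      then show ?thesis
        using op_weight_pos[OF \<nu>\<theta>(2,1), of m] e0[of m] by (simp add: norm_mult norm_power mult_ac)
    qed (simp add: egap)
    have Rsm: "summable (\<lambda>m. norm (?R m))"
      by (rule summable_comparison_test'[OF summable_mult[OF esm]]) (use Rbound in simp)
    have "norm (\<Sum>m. ?R m) \<le> (\<Sum>m. norm (?R m))"
      by (rule summable_norm[OF Rsm])
    also have "\<dots> \<le> (\<Sum>m. ?W n * norm z ^ n * e m)"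
      by (rule suminf_le[OF Rbound Rsm summable_mult[OF esm]])
    also have "\<dots> = ?W n * norm z ^ n * suminf e"
      by (rule suminf_mult[OF esm])
    also have "\<dots> \<le> ?W n * norm z ^ n * E"
      using eE op_weight_pos[OF \<nu>\<theta>(2,1), of n] by (intro mult_left_mono) auto
    also have "\<dots> = ?c * norm z ^ n"
      by (simp add: bound_coeff_eq E_def \<kappa>_def)
    finally have R: "norm (\<Sum>m. ?R m) \<le> ?c * norm z ^ n" .
    have "(\<lambda>m. of_real (?W m) * ((if m = 0 then 1 else - of_real (e m)) * z ^ m))
        = (\<lambda>m. (if m = 0 then of_real (?W 0) else 0) - ?R m)"
      using egap[of 0] n by (auto simp: fun_eq_iff)
    moreover have "(\<lambda>m. (if m = 0 then of_real (?W 0) else 0) - ?R m) sums (of_real (?W 0) - (\<Sum>m. ?R m))"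
      by (intro sums_diff sums_single summable_sums summable_norm_cancel[OF Rsm])
    ultimately have "norm (frac_integral \<nu> (I_op \<theta> p f) z) =
        norm z powr (real p + \<nu>) * norm (of_real (?W 0) - (\<Sum>m. ?R m))"
      using frac_integral_I_op_disc_series[OF fs par(1) \<nu>\<theta>(2,1) z False] by (simp add: sums_iff)
    moreover have "norm (of_real (?W 0) - (\<Sum>m. ?R m)) \<le> ?W 0 + ?c * norm z ^ n"
      using norm_triangle_ineq4[of "of_real (?W 0)" "\<Sum>m. ?R m"] R op_weight_pos[OF \<nu>\<theta>(2,1), of 0] by simp
    moreover have "?W 0 - ?c * norm z ^ n \<le> norm (of_real (?W 0) - (\<Sum>m. ?R m))"
      using norm_triangle_ineq2[of "of_real (?W 0)" "\<Sum>m. ?R m"] R op_weight_pos[OF \<nu>\<theta>(2,1), of 0] by simp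
    ultimately show ?thesis
      by (simp add: mult.commute mult_left_mono)
  qed
  then show "lower_bound n p \<delta> lam \<mu> l A B \<sigma> \<nu> \<theta> z \<le> norm (frac_integral \<nu> (I_op \<theta> p f) z)"
    and "norm (frac_integral \<nu> (I_op \<theta> p f) z) \<le> upper_bound n p \<delta> lam \<mu> l A B \<sigma> \<nu> \<theta> z"
    by (auto simp: lower_bound_def upper_bound_def W0)
qed

section \<open>Valence of a two-term polynomial\<close>

text \<open>
  The Noshiro-Warschawski criterion. Along the segment from \<open>a\<close> to \<open>b\<close> the real part of
  \<open>g / (b - a)\<close> has positive derivative, so its values at the two ends differ.
\<close>

lemma inj_on_of_Re_deriv_pos:
  fixes g g' :: "complex \<Rightarrow> complex"
  assumes "convex S"
    and deriv: "\<And>z. z \<in> S \<Longrightarrow> (g has_field_derivative g' z) (at z)"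
    and pos: "\<And>z. z \<in> S \<Longrightarrow> Re (g' z) > 0"
  shows "inj_on g S"
proof (rule inj_onI, rule ccontr)
  fix a b assume ab: "a \<in> S" "b \<in> S" "g a = g b" "a \<noteq> b"
  define \<gamma> where "\<gamma> = (\<lambda>t::real. a + of_real t * (b - a))"
  define h where "h = (\<lambda>t. Re (g (\<gamma> t) / (b - a)))"
  have "\<gamma> t \<in> S" if "0 \<le> t" "t \<le> 1" for t
  proof -
    have "\<gamma> t = (1 - t) *\<^sub>R a + t *\<^sub>R b"
      by (simp add: \<gamma>_def scaleR_conv_of_real algebra_simps)
    then show ?thesis using \<open>convex S\<close> ab that by (simp add: convexD_alt)
  qed
  then have \<gamma>S: "0 \<le> t \<Longrightarrow> t \<le> 1 \<Longrightarrow> \<gamma> t \<in> S" for t .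
  have dh: "(h has_real_derivative Re (g' (\<gamma> t))) (at t) \<and> 0 < Re (g' (\<gamma> t))"
    if "0 \<le> t" "t \<le> 1" for t
  proof
    note \<gamma>t = \<gamma>S[OF that]
    have "(\<gamma> has_vector_derivative (b - a)) (at t)"
      unfolding \<gamma>_def by (auto intro!: derivative_eq_intros)
    then have "((g \<circ> \<gamma>) has_vector_derivative (b - a) * g' (\<gamma> t)) (at t)"
      by (rule field_vector_diff_chain_at) (rule deriv[OF \<gamma>t])
    then have "((\<lambda>s. (g \<circ> \<gamma>) s / (b - a)) has_vector_derivative (b - a) * g' (\<gamma> t) / (b - a)) (at t)"
      by (rule bounded_linear.has_vector_derivative[OF bounded_linear_divide])
    then have "((\<lambda>s. Re ((g \<circ> \<gamma>) s / (b - a))) has_vector_derivative Re ((b - a) * g' (\<gamma> t) / (b - a))) (at t)"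
      by (rule bounded_linear.has_vector_derivative[OF bounded_linear_Re])
    then show "(h has_real_derivative Re (g' (\<gamma> t))) (at t)"
      using ab(4) by (simp add: h_def has_real_derivative_iff_has_vector_derivative)
    show "0 < Re (g' (\<gamma> t))" by (rule pos[OF \<gamma>t])
  qed
  have "h 0 < h 1"
    by (rule DERIV_pos_imp_increasing[OF zero_less_one]) (use dh in blast)
  then show False
    using ab(3) by (simp add: h_def \<gamma>_def)
qed

lemma Re_pos_imp_nonzero: "Re z > 0 \<Longrightarrow> z \<noteq> 0"
  by auto

lemma Im_Ln_same_sign:
  assumes "Re z > 0"
  shows "0 \<le> Im z \<longrightarrow> 0 \<le> Im (Ln z)" "Im z \<le> 0 \<longrightarrow> Im (Ln z) \<le> 0" "\<bar>Im (Ln z)\<bar> < pi / 2"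
proof -
  have z: "z \<noteq> 0" using assms by auto
  show lt: "\<bar>Im (Ln z)\<bar> < pi / 2" using Re_Ln_pos_lt[OF z] assms by simp
  show "0 \<le> Im z \<longrightarrow> 0 \<le> Im (Ln z)" using Im_Ln_pos_le[OF z] by blast
  show "Im z \<le> 0 \<longrightarrow> Im (Ln z) \<le> 0" using Im_Ln_pos_lt[OF z] lt pi_gt_zero by linarith
qed

lemma Re_one_minus_pos:
  fixes u :: complex
  assumes "0 \<le> \<alpha>" "\<alpha> \<le> 1" "norm u < 1"
  shows "Re (1 - of_real \<alpha> * u) > 0"
proof -
  have "\<bar>\<alpha> * Re u\<bar> \<le> 1 * \<bar>Re u\<bar>"
    unfolding abs_mult using assms by (intro mult_right_mono) auto
  also have "\<dots> \<le> norm u" using abs_Re_le_cmod[of u] by simp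
  finally show ?thesis using assms by simp
qed

text \<open>
  For a fixed \<open>u\<close> the numbers \<open>1 - \<alpha> * u\<close> and \<open>1 - c * u\<close> lie in the right half plane on the same side
  of the real axis. Their arguments thus have the same sign and modulus below \<open>pi / 2\<close>, and
  subtracting a fraction \<open>t\<close> of the second from the first keeps the modulus below \<open>pi / 2\<close>.
\<close>

lemma Re_exp_difference_pos:
  fixes u :: complex
  assumes c: "0 \<le> c" "c \<le> 1" and \<alpha>: "0 \<le> \<alpha>" "\<alpha> \<le> 1" and t: "0 \<le> t" "t \<le> 1" and u: "norm u < 1"
  shows "Re (exp (Ln (1 - of_real \<alpha> * u) - of_real t * Ln (1 - of_real c * u))) > 0"
proof -
  let ?a = "Im (Ln (1 - of_real \<alpha> * u))" and ?b = "Im (Ln (1 - of_real c * u))"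
  note A = Im_Ln_same_sign[OF Re_one_minus_pos[OF \<alpha> u]]
  note B = Im_Ln_same_sign[OF Re_one_minus_pos[OF c u]]
  have "\<bar>?a - t * ?b\<bar> < pi / 2"
  proof (cases "Im u \<le> 0")
    case True
    then have "0 \<le> ?a" "0 \<le> ?b"
      using A(1) B(1) \<alpha> c by (auto simp: mult_nonneg_nonpos)
    moreover from this have "0 \<le> t * ?b" "t * ?b \<le> ?b" using t by (auto simp: mult_left_le_one_le)
    ultimately show ?thesis using A(3) B(3) by linarith
  next
    case False
    then have "?a \<le> 0" "?b \<le> 0"
      using A(2) B(2) \<alpha> c by auto
    moreover from this have "t * ?b \<le> 0" "?b \<le> t * ?b"
      using t mult_right_mono_neg[of t 1 ?b] by (auto simp: mult_nonneg_nonpos)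
    ultimately show ?thesis using A(3) B(3) by linarith
  qed
  then have "0 < cos (?a - t * ?b)" by (intro cos_gt_zero_pi) linarith+
  then show ?thesis by (simp add: Re_exp)
qed

lemma two_term_coeff_less_1:
  fixes c :: real and n p :: nat
  assumes "n \<ge> 1" "(real n + real p) * c \<le> real p"
  shows "c < 1"
proof (rule ccontr)
  assume "\<not> c < 1"
  then have "(real n + real p) * 1 \<le> (real n + real p) * c" by (intro mult_left_mono) auto
  from order_trans[OF this assms(2)] show False using \<open>n \<ge> 1\<close> by simp
qed

text \<open>
  The function is the branch \<open>g\<close> with \<open>g z = z + \<dots>\<close> of the \<open>p\<close>-th root of \<open>z ^ p - c * z ^ (n + p)\<close>. With
  \<open>\<alpha> = (n + p) * c / p \<le> 1\<close> its derivative is \<open>(1 - \<alpha> * z ^ n) * (1 - c * z ^ n) powr (1 / p - 1)\<close>, whose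
  real part is positive by the comparison of arguments above.
\<close>

lemma two_term_root_inj_on:
  fixes n p :: nat and c :: real
  assumes "n \<ge> 1" "p \<ge> 1" "0 \<le> c" and c: "(real n + real p) * c \<le> real p"
  shows "inj_on (\<lambda>z. z * exp (Ln (1 - of_real c * z ^ n) / of_nat p)) unit_disc"
proof -
  define \<alpha> where "\<alpha> = (real n + real p) * c / real p"
  have \<alpha>: "0 \<le> \<alpha>" "\<alpha> \<le> 1" using assms by (auto simp: \<alpha>_def)
  have c1: "c \<le> 1" using two_term_coeff_less_1[OF assms(1) c] by simp
  define t where "t = 1 - 1 / real p"
  have t: "0 \<le> t" "t \<le> 1" using \<open>p \<ge> 1\<close> by (auto simp: t_def)
  let ?g' = "\<lambda>z. exp (Ln (1 - of_real \<alpha> * z ^ n) - of_real t * Ln (1 - of_real c * z ^ n))"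
  have "Re (?g' z) > 0 \<and> ((\<lambda>z. z * exp (Ln (1 - of_real c * z ^ n) / of_nat p)) has_field_derivative ?g' z) (at z)"
    if "z \<in> unit_disc" for z
  proof
  from that have u: "norm (z ^ n) < 1" using \<open>n \<ge> 1\<close> by (simp add: norm_power power_less_one_iff)
  show "Re (?g' z) > 0"
    by (rule Re_exp_difference_pos) (use assms \<alpha> t u c1 in auto)
  have Q: "Re (1 - of_real c * z ^ n) > 0" and P: "Re (1 - of_real \<alpha> * z ^ n) > 0"
    using Re_one_minus_pos[OF _ _ u] assms \<alpha> c1 by auto
  note nz = Re_pos_imp_nonzero[OF Q] Re_pos_imp_nonzero[OF P]
  have nR: "1 - of_real c * z ^ n \<notin> \<real>\<^sub>\<le>\<^sub>0"
    using Q by (simp only: complex_nonpos_Reals_iff) linarith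
  let ?Q = "1 - of_real c * z ^ n"
  have "((\<lambda>z. z * exp (Ln (1 - of_real c * z ^ n) / of_nat p)) has_field_derivative
      exp (Ln ?Q / of_nat p) + z * (exp (Ln ?Q / of_nat p) *
        (- (of_real c * (of_nat n * z ^ (n - 1))) / ?Q / of_nat p))) (at z)"
    using nR nz(1) \<open>p \<ge> 1\<close> by (auto intro!: derivative_eq_intros simp: divide_simps mult_ac)
  also have "exp (Ln ?Q / of_nat p) + z * (exp (Ln ?Q / of_nat p) *
        (- (of_real c * (of_nat n * z ^ (n - 1))) / ?Q / of_nat p))
      = exp (Ln ?Q / of_nat p) * (1 - of_real \<alpha> * z ^ n) / ?Q"
  proof -
    have collect: "E + z * (E * (- (C * (N * Z)) / Q / P)) = E * (1 - C * (N * (z * Z)) / (Q * P))"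
      for E C N Z Q P :: complex
      by (simp add: right_diff_distrib mult_ac)
    have zn: "z * z ^ (n - 1) = z ^ n" using \<open>n \<ge> 1\<close> by (simp flip: power_Suc)
    have \<alpha>c: "of_nat p * of_real \<alpha> = (of_nat n + of_nat p) * (of_real c :: complex)"
      using \<open>p \<ge> 1\<close> by (simp add: \<alpha>_def)
    have "1 - (of_real c * (of_nat n * z ^ n)) / (?Q * of_nat p) = (1 - of_real \<alpha> * z ^ n) / ?Q"
    proof -
      have "(?Q * of_nat p) - of_real c * (of_nat n * z ^ n) = of_nat p - (of_nat n + of_nat p) * of_real c * z ^ n"
        by (simp add: algebra_simps)
      also have "\<dots> = of_nat p * (1 - of_real \<alpha> * z ^ n)"
        unfolding \<alpha>c[symmetric] by (simp add: algebra_simps)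
      finally have eq: "?Q * of_nat p - of_real c * (of_nat n * z ^ n) = of_nat p * (1 - of_real \<alpha> * z ^ n)" .
      have nzp: "?Q * of_nat p \<noteq> 0" using nz(1) \<open>p \<ge> 1\<close> by simp
      have "1 - of_real c * (of_nat n * z ^ n) / (?Q * of_nat p)
          = (?Q * of_nat p - of_real c * (of_nat n * z ^ n)) / (?Q * of_nat p)"
        by (simp only: diff_divide_distrib divide_self[OF nzp])
      also have "\<dots> = (1 - of_real \<alpha> * z ^ n) / ?Q"
        unfolding eq using \<open>p \<ge> 1\<close> by simp
      finally show ?thesis .
    qed
    then show ?thesis
      using collect[of "exp (Ln ?Q / of_nat p)" "of_real c" "of_nat n" "z ^ (n - 1)" ?Q "of_nat p"]
      unfolding zn by (simp only: times_divide_eq_right)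
  qed
  also have "\<dots> = ?g' z"
  proof -
    have "?g' z = exp (Ln (1 - of_real \<alpha> * z ^ n)) * exp (Ln ?Q / of_nat p) / exp (Ln ?Q)"
      using \<open>p \<ge> 1\<close> by (simp add: t_def algebra_simps exp_diff exp_add)
    then show ?thesis using nz by simp
  qed
  finally show "((\<lambda>z. z * exp (Ln (1 - of_real c * z ^ n) / of_nat p)) has_field_derivative ?g' z) (at z)" .
  qed
  then show ?thesis
    by (intro inj_on_of_Re_deriv_pos[where g' = ?g'] convex_ball) blast+
qed

text \<open>
  The derivative \<open>p * z ^ (p - 1) * (1 - \<alpha> * z ^ n)\<close> with \<open>\<alpha> = (n + p) * c / p \<le> 1\<close> vanishes in
  the disc at most at the origin, so values attained elsewhere are simple.
\<close>

lemma zorder_two_term: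
  fixes n p :: nat and c :: real
  assumes n: "n \<ge> 1" and p: "p \<ge> 1" and c: "0 \<le> c" "(real n + real p) * c \<le> real p"
    and z: "z \<in> unit_disc" "z \<noteq> 0"
  shows "zorder (\<lambda>u. u ^ p - of_real c * u ^ (n + p) - (z ^ p - of_real c * z ^ (n + p))) z = 1"
proof -
  define h where "h = (\<lambda>u. u ^ p - of_real c * u ^ (n + p) - (z ^ p - of_real c * z ^ (n + p)))"
  define \<alpha> where "\<alpha> = (real n + real p) * c / real p"
  have \<alpha>: "0 \<le> \<alpha>" "\<alpha> \<le> 1" using p c by (auto simp: \<alpha>_def)
  have "norm (z ^ n) < 1" using z n by (simp add: norm_power power_less_one_iff)
  then have "Re (1 - of_real \<alpha> * z ^ n) > 0" using \<alpha> by (intro Re_one_minus_pos) auto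
  then have nz: "1 - of_real \<alpha> * z ^ n \<noteq> 0" by (rule Re_pos_imp_nonzero)
  have "(h has_field_derivative
      of_nat p * z ^ (p - 1) - of_real c * (of_nat (n + p) * z ^ (n + p - 1))) (at z)"
    unfolding h_def by (auto intro!: derivative_eq_intros)
  also have "of_nat p * z ^ (p - 1) - of_real c * (of_nat (n + p) * z ^ (n + p - 1))
      = of_nat p * z ^ (p - 1) * (1 - of_real \<alpha> * z ^ n)"
  proof -
    have "n + p - 1 = n + (p - 1)" using p by simp
    then have zn: "z ^ (n + p - 1) = z ^ n * z ^ (p - 1)" by (simp only: power_add)
    have \<alpha>c: "of_nat (n + p) * (of_real c :: complex) = of_nat p * of_real \<alpha>"
      using p by (simp add: \<alpha>_def)
    have "of_real c * (of_nat (n + p) * z ^ (n + p - 1)) = of_nat (n + p) * of_real c * (z ^ n * z ^ (p - 1))"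
      unfolding zn by (simp only: mult_ac)
    then show ?thesis unfolding \<alpha>c by (simp only: right_diff_distrib mult_ac mult_1_left mult_1_right)
  qed
  finally have "deriv h z = of_nat p * z ^ (p - 1) * (1 - of_real \<alpha> * z ^ n)"
    by (rule DERIV_imp_deriv)
  then have "deriv h z \<noteq> 0" using nz z p by simp
  moreover have "h z = 0" by (simp add: h_def)
  moreover have "h holomorphic_on unit_disc" unfolding h_def by (intro holomorphic_intros)
  ultimately have "zorder h z = 1"
    using z(1) by (intro zorder_zero_eqI[where S = unit_disc]) auto
  then show ?thesis by (simp only: h_def)
qed

text \<open>
  The polynomial is \<open>g ^ p\<close> with \<open>g\<close> injective, so a value \<open>w \<noteq> 0\<close> has at most one preimage for each of the
  \<open>p\<close> roots of \<open>v ^ p = w\<close>, all of them simple. The value 0 is taken at the origin only, with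
  multiplicity exactly \<open>p\<close>.
\<close>

lemma p_valent_two_term:
  fixes n p :: nat and c :: real
  assumes n: "n \<ge> 1" and p: "p \<ge> 1" and c: "0 \<le> c" "(real n + real p) * c \<le> real p"
  shows "p_valent p (\<lambda>z. z ^ p - of_real c * z ^ (n + p))"
proof -
  let ?f = "\<lambda>z::complex. z ^ p - of_real c * z ^ (n + p)"
  let ?g = "\<lambda>z. z * exp (Ln (1 - of_real c * z ^ n) / of_nat p)"
  have c1: "c < 1" by (rule two_term_coeff_less_1[OF n c(2)])
  have nz: "1 - of_real c * z ^ n \<noteq> 0" if "z \<in> unit_disc" for z
  proof -
    have "norm (z ^ n) < 1" using that n by (simp add: norm_power power_less_one_iff)
    then have "Re (1 - of_real c * z ^ n) > 0" using c c1 by (intro Re_one_minus_pos) auto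
    then show ?thesis by (rule Re_pos_imp_nonzero)
  qed
  have factor: "?f z = z ^ p * (1 - of_real c * z ^ n)" for z
    by (simp add: algebra_simps power_add)
  have root: "?g z ^ p = ?f z" if "z \<in> unit_disc" for z
  proof -
    have "?g z ^ p = z ^ p * exp (of_nat p * (Ln (1 - of_real c * z ^ n) / of_nat p))"
      by (simp only: power_mult_distrib exp_of_nat_mult)
    then show ?thesis using p nz[OF that] by (simp add: factor)
  qed
  have zero: "{z \<in> unit_disc. ?f z = 0} = {0}"
    using nz p unfolding factor by auto
  have ord0: "zorder (\<lambda>u. ?f u - 0) 0 = int p"
  proof (rule zorder_eqI[where S = unit_disc])
    show "?f w - 0 = (1 - of_real c * w ^ n) * (w - 0) powi int p" for w
      by (simp only: factor diff_zero power_int_of_nat mult.commute)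
  qed (use nz in \<open>auto intro!: holomorphic_intros\<close>)
  have nonzero: "finite {z \<in> unit_disc. ?f z = w} \<and>
      (\<Sum>z | z \<in> unit_disc \<and> ?f z = w. zorder (\<lambda>u. ?f u - w) z) \<le> int p" if w: "w \<noteq> 0" for w
  proof
    let ?S = "{z \<in> unit_disc. ?f z = w}"
    have inj: "inj_on ?g ?S"
      by (rule inj_on_subset[OF two_term_root_inj_on]) (use n p c in auto)
    have sub: "?g ` ?S \<subseteq> {v. v ^ p = w}"
    proof (rule image_subsetI)
      fix z assume "z \<in> ?S"
      then show "?g z \<in> {v. v ^ p = w}" using root[of z] by (simp only: mem_Collect_eq)
    qed
    have fin: "finite {v::complex. v ^ p = w}" using p by (intro finite_nth_roots) auto
    show "finite ?S" using inj_on_finite[OF inj sub fin] .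
    have "card ?S \<le> card {v::complex. v ^ p = w}" by (rule card_inj_on_le[OF inj sub fin])
    also have "\<dots> = p" using w p by (intro card_nth_roots) auto
    finally have card: "card ?S \<le> p" .
    have simple: "zorder (\<lambda>u. ?f u - w) z = 1" if z: "z \<in> ?S" for z
    proof -
      have "z \<noteq> 0" using z w p by (auto simp: zero_power)
      then show ?thesis using zorder_two_term[OF n p c, of z] z by simp
    qed
    have "(\<Sum>z | z \<in> unit_disc \<and> ?f z = w. zorder (\<lambda>u. ?f u - w) z) = (\<Sum>z\<in>?S. 1)"
      by (rule sum.cong[OF refl]) (rule simple)
    with card show "(\<Sum>z | z \<in> unit_disc \<and> ?f z = w. zorder (\<lambda>u. ?f u - w) z) \<le> int p"
      by simp
  qed
  have sum0: "(\<Sum>z | z \<in> unit_disc \<and> ?f z = 0. zorder (\<lambda>u. ?f u - 0) z) = int p"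
    using zero ord0 by simp
  have fin: "finite {z \<in> unit_disc. ?f z = w}" for w
    using nonzero[of w] zero by (cases "w = 0") auto
  have le: "(\<Sum>z | z \<in> unit_disc \<and> ?f z = w. zorder (\<lambda>u. ?f u - w) z) \<le> int p" for w
  proof (cases "w = 0")
    case True
    show ?thesis unfolding True sum0 by simp
  next
    case False
    from conjunct2[OF nonzero[OF this]] show ?thesis .
  qed
  show ?thesis
    unfolding p_valent_def
  proof (rule conjI)
    show "\<exists>w. (\<Sum>z | z \<in> unit_disc \<and> ?f z = w. zorder (\<lambda>u. ?f u - w) z) = int p"
      by (rule exI[of _ 0]) (rule sum0)
  qed (intro allI conjI fin le)
qed

section \<open>The extremal function and sharpness\<close>

text \<open>
  The value of \<open>e n\<close> that turns the inequality of \<open>class_P_tilde_coefficients\<close> into an equality when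
  all other \<open>e m\<close> vanish.
\<close>

definition extremal_coeff ::
  "nat \<Rightarrow> nat \<Rightarrow> real \<Rightarrow> real \<Rightarrow> real \<Rightarrow> real \<Rightarrow> real \<Rightarrow> real \<Rightarrow> real \<Rightarrow> real" where
  "extremal_coeff n p \<delta> lam \<mu> l A B \<sigma> =
     (real p - \<sigma>) * (B - A) / (1 + B) / (real (p + n) * Phi p \<delta> lam \<mu> l (n + p))"

definition extremal_fun :: "real \<Rightarrow> nat \<Rightarrow> nat \<Rightarrow> complex \<Rightarrow> complex" where
  "extremal_fun c n p z = z ^ p - of_real c * z ^ (n + p)"

text \<open>
  The upper bound is the hypothesis under which the two-term polynomial is \<open>p\<close>-valent. It follows
  from \<open>Phi \<ge> 1\<close>, \<open>B - A \<le> 1 + B\<close> and \<open>p - \<sigma> \<le> p\<close>.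
\<close>

lemma extremal_coeff_bounds:
  assumes par: "p \<ge> 1" "\<mu> \<le> lam" "0 \<le> \<mu>" "0 \<le> l" "0 \<le> \<delta>"
    and AB: "- 1 \<le> A" "A < B" "B \<le> 1" "0 < B" and \<sigma>: "0 \<le> \<sigma>" "\<sigma> < real p"
  shows "0 \<le> extremal_coeff n p \<delta> lam \<mu> l A B \<sigma>"
    and "(real n + real p) * extremal_coeff n p \<delta> lam \<mu> l A B \<sigma> \<le> real p"
proof -
  have \<Phi>: "Phi p \<delta> lam \<mu> l (n + p) \<ge> 1" by (rule Phi_ge_1[OF par]) simp
  show "0 \<le> extremal_coeff n p \<delta> lam \<mu> l A B \<sigma>"
    unfolding extremal_coeff_def using AB \<sigma> \<Phi> by (intro divide_nonneg_nonneg mult_nonneg_nonneg) auto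
  have "(real n + real p) * extremal_coeff n p \<delta> lam \<mu> l A B \<sigma>
      = (real p - \<sigma>) * ((B - A) / (1 + B)) / Phi p \<delta> lam \<mu> l (n + p)"
    using par(1) by (simp add: extremal_coeff_def add.commute)
  also have "\<dots> \<le> (real p - \<sigma>) * ((B - A) / (1 + B)) / 1"
    using \<Phi> AB \<sigma> by (intro divide_left_mono mult_nonneg_nonneg divide_nonneg_nonneg) auto
  also have "\<dots> \<le> real p * 1"
    unfolding div_by_1 using AB \<sigma> by (intro mult_mono) (auto simp: divide_simps)
  finally show "(real n + real p) * extremal_coeff n p \<delta> lam \<mu> l A B \<sigma> \<le> real p" by simp
qed

lemma sums_two_terms:
  fixes h :: "nat \<Rightarrow> complex"
  assumes "n \<ge> 1" "\<And>m. m \<noteq> 0 \<Longrightarrow> m \<noteq> n \<Longrightarrow> h m = 0"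
  shows "h sums (h 0 + h n)"
proof -
  have "h sums (\<Sum>m\<in>{0, n}. h m)" using assms by (intro sums_finite) auto
  then show ?thesis using assms(1) by simp
qed

lemma extremal_fun_disc_series:
  assumes "n \<ge> 1"
  shows "disc_series p (\<lambda>m. if m = 0 then 1 else if m = n then - of_real c else 0) (extremal_fun c n p)"
  unfolding disc_series_def
proof
  fix z :: complex
  have S: "(\<lambda>m. (if m = 0 then 1 else if m = n then - of_real c else 0) * z ^ m) sums (1 - of_real c * z ^ n)"
    using sums_two_terms[OF assms, of "\<lambda>m. (if m = 0 then 1 else if m = n then - of_real c else 0) * z ^ m"]
      assms by simp
  show "summable (\<lambda>m. (if m = 0 then 1 else if m = n then - of_real c else 0) * z ^ m) \<and>
      extremal_fun c n p z = z ^ p * (\<Sum>m. (if m = 0 then 1 else if m = n then - of_real c else 0) * z ^ m)"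
    unfolding sums_unique[OF S, symmetric]
    by (rule conjI[OF sums_summable[OF S]]) (simp add: extremal_fun_def algebra_simps power_add)
qed

lemma extremal_fun_in_class_A:
  assumes n: "n \<ge> 1" and p: "p \<ge> 1" and c: "0 \<le> c" "(real n + real p) * c \<le> real p"
  shows "extremal_fun c n p \<in> class_A n p"
    and "\<exists>a :: nat \<Rightarrow> complex. \<forall>z\<in>unit_disc.
       ((\<lambda>k. of_real (norm (a k)) * z ^ k) has_sum (z ^ p - extremal_fun c n p z)) {n + p..}"
proof -
  have hs: "((\<lambda>k. (if k = n + p then d else 0) * z ^ k) has_sum (d * z ^ (n + p))) {n + p..}" for d z :: complex
  proof -
    have "((\<lambda>k. (if k = n + p then d else 0) * z ^ k) has_sum (\<Sum>k\<in>{n + p}. (if k = n + p then d else 0) * z ^ k)) {n + p}"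
      by (rule has_sum_finite) simp
    also have "?this \<longleftrightarrow> ((\<lambda>k. (if k = n + p then d else 0) * z ^ k) has_sum
        (\<Sum>k\<in>{n + p}. (if k = n + p then d else 0) * z ^ k)) {n + p..}"
      by (rule has_sum_cong_neutral) auto
    finally show ?thesis by simp
  qed
  have "extremal_fun c n p holomorphic_on unit_disc"
    unfolding extremal_fun_def by (intro holomorphic_intros)
  moreover have "\<forall>z\<in>unit_disc. ((\<lambda>k. (if k = n + p then - of_real c else 0) * z ^ k)
      has_sum (extremal_fun c n p z - z ^ p)) {n + p..}"
    using hs[of "- of_real c"] by (simp add: extremal_fun_def)
  moreover have "p_valent p (extremal_fun c n p)"
    using p_valent_two_term[OF n p c] by (simp add: extremal_fun_def[abs_def])
  ultimately show "extremal_fun c n p \<in> class_A n p"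
    unfolding class_A_def
    by (intro CollectI conjI exI[of _ "\<lambda>k. if k = n + p then - of_real c else 0"])
  have "(\<lambda>k. of_real (norm (if k = n + p then of_real c else 0 :: complex))) =
      (\<lambda>k. if k = n + p then of_real c else (0::complex))"
    using c by auto
  then show "\<exists>a :: nat \<Rightarrow> complex. \<forall>z\<in>unit_disc.
       ((\<lambda>k. of_real (norm (a k)) * z ^ k) has_sum (z ^ p - extremal_fun c n p z)) {n + p..}"
    using hs[of "of_real c"] by (intro exI[of _ "\<lambda>k. if k = n + p then of_real c else 0"])
      (simp add: extremal_fun_def fun_eq_iff)
qed

text \<open>
  For this function the left-hand side of the subordination is \<open>1 - (B - A) / (1 + B) * z ^ n\<close>. Solving
  \<open>(1 + A * w) / (1 + B * w) = 1 - (B - A) / (1 + B) * z ^ n\<close> for \<open>w\<close> gives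
  \<open>w = z ^ n / (1 + B - B * z ^ n)\<close>, and the denominator has modulus at least \<open>1 + B - B = 1\<close>.
\<close>

lemma extremal_fun_in_class_P_tilde:
  assumes par: "p \<ge> 1" "\<mu> \<le> lam" "0 \<le> \<mu>" "0 \<le> l" "0 \<le> \<delta>" and n: "n \<ge> 1"
    and AB: "- 1 \<le> A" "A < B" "B \<le> 1" "0 < B" and \<sigma>: "0 \<le> \<sigma>" "\<sigma> < real p"
  shows "extremal_fun (extremal_coeff n p \<delta> lam \<mu> l A B \<sigma>) n p \<in> class_P_tilde n p \<delta> lam \<mu> l A B \<sigma>"
proof -
  define c where "c = extremal_coeff n p \<delta> lam \<mu> l A B \<sigma>"
  let ?f = "extremal_fun c n p"
  let ?\<Phi> = "Phi p \<delta> lam \<mu> l"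
  have c: "0 \<le> c" "(real n + real p) * c \<le> real p"
    using extremal_coeff_bounds[OF par AB \<sigma>] by (auto simp: c_def)
  note A = extremal_fun_in_class_A[OF n par(1) c]
  let ?\<beta> = "\<lambda>m. if m = 0 then 1 else if m = n then - complex_of_real c else 0"
  let ?F = "\<lambda>z. 1 / (of_nat p - of_real \<sigma>) *
      (remove_sings (\<lambda>u. deriv (J_op n p \<delta> lam \<mu> l ?f) u / u ^ (p - 1)) z - of_real \<sigma>)"
  let ?S = "\<lambda>z. of_real ((B - A) / (1 + B)) * z ^ n :: complex"
  have Js: "disc_series p (\<lambda>m. of_real (?\<Phi> (m + p)) * ?\<beta> m) (J_op n p \<delta> lam \<mu> l ?f)"
    by (rule J_op_disc_series[OF par extremal_fun_disc_series[OF n]]) (use n in auto)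
  have F: "?F z = 1 - ?S z" if z: "z \<in> unit_disc" for z
  proof -
    let ?h = "\<lambda>m. of_nat (p + m) * (of_real (?\<Phi> (m + p)) * ?\<beta> m) * z ^ m"
    have "?h sums (?h 0 + ?h n)" by (rule sums_two_terms[OF n]) simp
    with remove_sings_deriv_disc_series[OF Js par(1) z]
    have "remove_sings (\<lambda>u. deriv (J_op n p \<delta> lam \<mu> l ?f) u / u ^ (p - 1)) z = ?h 0 + ?h n"
      by (rule sums_unique2)
    also have "\<dots> = of_nat p - of_real (real (p + n) * ?\<Phi> (n + p) * c) * z ^ n"
      using n Phi_at_degree[of p l] par by (simp add: mult_ac)
    also have "real (p + n) * ?\<Phi> (n + p) * c = (real p - \<sigma>) * ((B - A) / (1 + B))"
      using Phi_ge_1[OF par, of "n + p"] par(1) by (simp add: c_def extremal_coeff_def)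
    finally have rs: "remove_sings (\<lambda>u. deriv (J_op n p \<delta> lam \<mu> l ?f) u / u ^ (p - 1)) z
        = of_nat p - of_real ((real p - \<sigma>) * ((B - A) / (1 + B))) * z ^ n" .
    have "?F z = 1 / (of_nat p - of_real \<sigma>) * (of_real (real p - \<sigma>) - of_real (real p - \<sigma>) * ?S z)"
      unfolding rs by (simp add: mult.assoc)
    also have "\<dots> = 1 / of_real (real p - \<sigma>) * (of_real (real p - \<sigma>) * (1 - ?S z))"
      by (simp add: right_diff_distrib)
    also have "\<dots> = 1 - ?S z"
      using \<sigma> by (simp del: of_real_diff)
    finally show ?thesis .
  qed
  let ?w = "\<lambda>z::complex. z ^ n / (1 + of_real B - of_real B * z ^ n)"
  have wlt: "norm (?w z) < 1" and Dnz: "1 + of_real B - of_real B * z ^ n \<noteq> 0"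
    if z: "z \<in> unit_disc" for z
  proof -
    have u: "norm (z ^ n) < 1" using z n by (simp add: norm_power power_less_one_iff)
    have "norm (of_real B * z ^ n) \<le> B" using u AB by (simp add: norm_mult mult_left_le)
    moreover have "norm (of_real (1 + B) :: complex) = 1 + B" using AB by (simp del: of_real_add)
    ultimately have "1 \<le> norm (of_real (1 + B) - of_real B * z ^ n)"
      using norm_triangle_ineq2[of "of_real (1 + B)" "of_real B * z ^ n"] by linarith
    then have D: "1 \<le> norm (1 + of_real B - of_real B * z ^ n)" by simp
    then show "1 + of_real B - of_real B * z ^ n \<noteq> 0" by auto
    show "norm (?w z) < 1"
      unfolding norm_divide using u D by (subst divide_less_eq_1_pos) linarith+
  qed
  have Gnz: "1 + of_real B * z \<noteq> 0" if "z \<in> unit_disc" for z :: complex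
  proof -
    have "Re (1 - of_real B * (- z)) > 0" using that AB by (intro Re_one_minus_pos) auto
    then show ?thesis using Re_pos_imp_nonzero by fastforce
  qed
  have "subordinate ?F (\<lambda>z. (1 + of_real A * z) / (1 + of_real B * z))"
    unfolding subordinate_def
  proof (intro conjI exI[of _ ?w] ballI)
    have "(\<lambda>z. 1 - ?S z) holomorphic_on unit_disc" by (intro holomorphic_intros)
    then show "?F holomorphic_on unit_disc"
      by (rule holomorphic_transform) (rule F[symmetric])
    show "(\<lambda>z. (1 + of_real A * z) / (1 + of_real B * z)) holomorphic_on unit_disc"
      using Gnz by (intro holomorphic_intros) auto
    show "?w holomorphic_on unit_disc"
      using Dnz by (intro holomorphic_intros) auto
    show "?w 0 = 0" using n by simp
    fix z :: complex assume z: "z \<in> unit_disc"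
    show "norm (?w z) < 1" by (rule wlt[OF z])
    let ?D = "1 + of_real B - of_real B * z ^ n"
    have B1: "1 + of_real B \<noteq> (0::complex)" using AB by (simp add: complex_eq_iff)
    have num: "1 + of_real A * ?w z = (1 + of_real B - of_real (B - A) * z ^ n) / ?D"
      using Dnz[OF z] by (simp add: divide_simps) (simp add: algebra_simps)
    have den: "1 + of_real B * ?w z = (1 + of_real B) / ?D"
      using Dnz[OF z] by (simp add: divide_simps)
    have "(1 + of_real A * ?w z) / (1 + of_real B * ?w z)
        = (1 + of_real B - of_real (B - A) * z ^ n) / (1 + of_real B)"
      unfolding num den using Dnz[OF z] by simp
    also have "\<dots> = 1 - ?S z"
      unfolding of_real_divide of_real_add of_real_1 times_divide_eq_left
      by (simp only: diff_divide_distrib divide_self[OF B1])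
    finally show "?F z = (1 + of_real A * ?w z) / (1 + of_real B * ?w z)"
      using F[OF z] by simp
  qed
  then show ?thesis
    using A unfolding c_def[symmetric] class_P_tilde_def class_P_def by blast
qed

lemma norm_frac_integral_extremal_fun:
  assumes "p \<ge> 1" "n \<ge> 1" "- real p < \<theta>" "0 < \<nu>" and z: "z \<in> unit_disc" "z \<noteq> 0"
  shows "norm (frac_integral \<nu> (I_op \<theta> p (extremal_fun c n p)) z) =
     norm z powr (real p + \<nu>) *
       norm (of_real (op_weight \<nu> \<theta> p 0) - of_real (op_weight \<nu> \<theta> p n * c) * z ^ n)"
proof -
  let ?h = "\<lambda>m. of_real (op_weight \<nu> \<theta> p m) *
      ((if m = 0 then 1 else if m = n then - of_real c else 0) * z ^ m)"
  have "?h sums (?h 0 + ?h n)" by (rule sums_two_terms[OF assms(2)]) simp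
  then have "suminf ?h = of_real (op_weight \<nu> \<theta> p 0) - of_real (op_weight \<nu> \<theta> p n * c) * z ^ n"
    using assms(2) by (simp add: sums_iff)
  then show ?thesis
    using frac_integral_I_op_disc_series[OF extremal_fun_disc_series[OF assms(2)] assms(1,3,4) z] by simp
qed

theorem theorem7p1:
  fixes n p :: nat and lam \<mu> l \<delta> A B \<sigma> \<nu> \<theta> :: real
  assumes "n \<ge> 1" and "p \<ge> 1"
    and "\<mu> \<le> lam" and "0 \<le> \<mu>" and "0 \<le> l" and "0 \<le> \<delta>"
    and "-1 \<le> A" and "A < B" and "B \<le> 1" and "0 < B"
    and "0 \<le> \<sigma>" and "\<sigma> < real p"
    and "0 < \<nu>" and "- real p < \<theta>"
  shows "(\<forall>f \<in> class_P_tilde n p \<delta> lam \<mu> l A B \<sigma>. \<forall>z \<in> unit_disc.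
            norm (frac_integral \<nu> (I_op \<theta> p f) z) \<ge> lower_bound n p \<delta> lam \<mu> l A B \<sigma> \<nu> \<theta> z \<and>
            norm (frac_integral \<nu> (I_op \<theta> p f) z) \<le> upper_bound n p \<delta> lam \<mu> l A B \<sigma> \<nu> \<theta> z) \<and>
         (\<exists>f \<in> class_P_tilde n p \<delta> lam \<mu> l A B \<sigma>. \<exists>z \<in> unit_disc. z \<noteq> 0 \<and>
            norm (frac_integral \<nu> (I_op \<theta> p f) z) = lower_bound n p \<delta> lam \<mu> l A B \<sigma> \<nu> \<theta> z) \<and>
         (\<exists>f \<in> class_P_tilde n p \<delta> lam \<mu> l A B \<sigma>. \<exists>z \<in> unit_disc. z \<noteq> 0 \<and>
            norm (frac_integral \<nu> (I_op \<theta> p f) z) = upper_bound n p \<delta> lam \<mu> l A B \<sigma> \<nu> \<theta> z)"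
proof -
  note par = assms(2-6) and n = assms(1) and AB = assms(7-10) and \<sigma> = assms(11,12)
    and \<nu>\<theta> = assms(13,14)
  define c where "c = extremal_coeff n p \<delta> lam \<mu> l A B \<sigma>"
  let ?f = "extremal_fun c n p"
  let ?W = "op_weight \<nu> \<theta> p"
  let ?b = "bound_coeff n p \<delta> lam \<mu> l A B \<sigma> \<nu> \<theta>"
  have W0: "?W 0 = Gamma (real p + 1) / Gamma (real p + 1 + \<nu>)"
    using \<nu>\<theta> by (simp add: op_weight_def)
  have b: "?b = ?W n * c"
    by (simp add: bound_coeff_eq c_def extremal_coeff_def)
  have f: "?f \<in> class_P_tilde n p \<delta> lam \<mu> l A B \<sigma>"
    unfolding c_def by (rule extremal_fun_in_class_P_tilde[OF par n AB \<sigma>])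
  have c: "0 \<le> c" "(real n + real p) * c \<le> real p"
    unfolding c_def using extremal_coeff_bounds[OF par AB \<sigma>] by auto
  have c1: "c \<le> 1" using two_term_coeff_less_1[OF n c(2)] by simp
  have Wpos: "0 < ?W m" for m by (rule op_weight_pos[OF \<nu>\<theta>(2,1)])
  have b0: "0 \<le> ?b" unfolding b using Wpos[of n] c by simp
  have "?b \<le> ?W n * 1" unfolding b using Wpos[of n] c1 by (intro mult_left_mono) auto
  also have "\<dots> \<le> ?W 0" using op_weight_antimono[OF \<nu>\<theta>(2,1), of 0 n] by simp
  finally have bW: "?b \<le> ?W 0" .
  note ext = norm_frac_integral_extremal_fun[OF par(1) n \<nu>\<theta>(2,1), of _ c, folded b]
  \<comment> \<open>At a positive point \<open>z ^ n > 0\<close>, and the difference of the two terms is nonnegative.\<close>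
  have lower: "norm (frac_integral \<nu> (I_op \<theta> p ?f) z) = lower_bound n p \<delta> lam \<mu> l A B \<sigma> \<nu> \<theta> z"
    if z: "z = of_real (1 / 2)" for z
  proof -
    have "?b * (1 / 2) ^ n \<le> ?b * 1" using b0 by (intro mult_left_mono power_le_one) auto
    then have nn: "0 \<le> ?W 0 - ?b * (1 / 2) ^ n" using bW by simp
    have "of_real (?W 0) - of_real ?b * z ^ n = complex_of_real (?W 0 - ?b * (1 / 2) ^ n)"
      by (simp add: z)
    then have "norm (of_real (?W 0) - of_real ?b * z ^ n) = ?W 0 - ?b * (1 / 2) ^ n"
      using nn by (simp only: norm_of_real abs_of_nonneg)
    moreover have "z \<in> unit_disc" "z \<noteq> 0" "norm z = 1 / 2" by (auto simp: z)
    ultimately show ?thesis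
      using ext[of z] by (simp only: lower_bound_def W0 mult.commute simp_thms)
  qed
  \<comment> \<open>At a point with \<open>z ^ n < 0\<close> both terms have the same sign; an \<open>n\<close>-th root of \<open>-1\<close> supplies the direction.\<close>
  have upper: "norm (frac_integral \<nu> (I_op \<theta> p ?f) z) = upper_bound n p \<delta> lam \<mu> l A B \<sigma> \<nu> \<theta> z"
    if z: "z = of_real (1 / 2) * cis (pi / real n)" for z
  proof -
    have "z ^ n = of_real ((1 / 2) ^ n) * cis (real n * (pi / real n))"
      unfolding z power_mult_distrib Complex.DeMoivre by simp
    also have "real n * (pi / real n) = pi" using n by simp
    finally have "of_real (?W 0) - of_real ?b * z ^ n = complex_of_real (?W 0 + ?b * (1 / 2) ^ n)"
      by simp
    moreover have "0 \<le> ?W 0 + ?b * (1 / 2) ^ n" using b0 Wpos[of 0] by simp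
    ultimately have "norm (of_real (?W 0) - of_real ?b * z ^ n) = ?W 0 + ?b * (1 / 2) ^ n"
      by (simp only: norm_of_real abs_of_nonneg)
    moreover have "z \<in> unit_disc" "z \<noteq> 0" "norm z = 1 / 2" by (auto simp: z norm_mult)
    ultimately show ?thesis
      using ext[of z] by (simp only: upper_bound_def W0 mult.commute simp_thms)
  qed
  show ?thesis
  proof (intro conjI ballI)
    fix f z assume "f \<in> class_P_tilde n p \<delta> lam \<mu> l A B \<sigma>" "z \<in> unit_disc"
    from distortion_bounds[OF par n AB \<sigma>(2) \<nu>\<theta> this]
    show "norm (frac_integral \<nu> (I_op \<theta> p f) z) \<ge> lower_bound n p \<delta> lam \<mu> l A B \<sigma> \<nu> \<theta> z"
      and "norm (frac_integral \<nu> (I_op \<theta> p f) z) \<le> upper_bound n p \<delta> lam \<mu> l A B \<sigma> \<nu> \<theta> z" .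
  next
    have "complex_of_real (1 / 2) \<in> unit_disc \<and> complex_of_real (1 / 2) \<noteq> 0" by simp
    then show "\<exists>f \<in> class_P_tilde n p \<delta> lam \<mu> l A B \<sigma>. \<exists>z \<in> unit_disc. z \<noteq> 0 \<and>
            norm (frac_integral \<nu> (I_op \<theta> p f) z) = lower_bound n p \<delta> lam \<mu> l A B \<sigma> \<nu> \<theta> z"
      using f lower[OF refl] by blast
    have "of_real (1 / 2) * cis (pi / real n) \<in> unit_disc \<and> of_real (1 / 2) * cis (pi / real n) \<noteq> 0"
      by (simp add: norm_mult)
    then show "\<exists>f \<in> class_P_tilde n p \<delta> lam \<mu> l A B \<sigma>. \<exists>z \<in> unit_disc. z \<noteq> 0 \<and>
            norm (frac_integral \<nu> (I_op \<theta> p f) z) = upper_bound n p \<delta> lam \<mu> l A B \<sigma> \<nu> \<theta> z"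
      using f upper[OF refl] by blast
  qed
qed

end
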